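(* Let $V$ be a discrete valuation ring with maximal ideal $\pi V$, fraction field $K$ and finite residue field $V/\pi V\cong\mathbb{F}_q$, and let $n\ge 2$. The $\pi$-sequence $\mu_0,\mu_1,\ldots$ of $\mathrm{Int}_K(M_n(V))$ satisfies $$\mu_d=\left\lfloor \frac{d}{\deg\Phi_{q,n}}\right\rfloor\quad\text{for } 0\le d\le q\cdot\deg\Phi_{q,n}.$$
   Context: $\mathrm{Int}_K(M_n(V))=\{f\in K[x]\mid f(M_n(V))\subseteq M_n(V)\}$, with evaluation in $M_n(K)$. Express polynomials of $K[x]$ in lowest terms, i.e. in the form $g(x)/\pi^k$ with $g\in V[x]$, $k\ge0$, and, if $k>0$, $\pi$ does not divide $g$ in $V[x]$. The $\pi$-sequence $\mu_0,\mu_1,\ldots$ of $\mathrm{Int}_K(M_n(V))$ is the sequence of non-negative integers $$\mu_d=\max\{k\mid\text{there exists } g_d(x)/\pi^k\in\mathrm{Int}_K(M_n(V))\text{ (in lowest terms) of degree } d\}.$$ Also $\Phi_{q,n}(x)=(x^{q^n}-x)(x^{q^{n-1}}-x)\cdots(x^q-x)$. *)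

theory Defs
  imports
    "HOL-Algebra.Algebraic_Closure_Type"
    "HOL-Computational_Algebra.Polynomial_Factorial"
    "Jordan_Normal_Form.Matrix"
begin

text \<open>
  A discrete valuation ring is a local principal ideal domain that is not a field.
  The ring \<open>V\<close> is a type of class \<^class>\<open>idom\<close>, with fraction field
  \<^typ>\<open>'v::idom fract\<close>; its ideals and residue ring are those of
  the record \<^const>\<open>ring_of_type_algebra\<close>.
\<close>

definition discrete_valuation_ring :: "('a, 'b) ring_scheme \<Rightarrow> bool" where
  "discrete_valuation_ring R \<longleftrightarrow>
     principal_domain R \<and> \<not> field R \<and> (\<exists>!M. maximalideal M R)"

abbreviation type_ring :: "'v::idom ring" where
  "type_ring \<equiv> ring_of_type_algebra"

definition eval_poly_mat :: "'k::field poly \<Rightarrow> 'k mat \<Rightarrow> 'k mat" where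
  "eval_poly_mat f A = mat (dim_row A) (dim_row A)
     (\<lambda>(i, j). \<Sum>k\<le>Polynomial.degree f. Polynomial.coeff f k * (A ^\<^sub>m k) $$ (i, j))"

definition integral_mats :: "nat \<Rightarrow> 'v::idom fract mat set" where
  "integral_mats n = map_mat to_fract ` carrier_mat n n"

definition Int_mats :: "nat \<Rightarrow> 'v::idom fract poly set" where
  "Int_mats n = {f. \<forall>A \<in> integral_mats n. eval_poly_mat f A \<in> integral_mats n}"

definition lowest_terms ::
    "'v::idom \<Rightarrow> 'v fract poly \<Rightarrow> 'v poly \<Rightarrow> nat \<Rightarrow> bool" where
  "lowest_terms \<pi> f g k \<longleftrightarrow>
     f = Polynomial.smult (1 / to_fract \<pi> ^ k) (map_poly to_fract g) \<and>
     (k > 0 \<longrightarrow> \<not> [:\<pi>:] dvd g)"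

text \<open>
  The zero polynomial, which has library degree \<open>0\<close>, is in lowest terms only for
  \<open>k = 0\<close>, so it does not affect the maximum.
\<close>

definition pi_sequence :: "'v::idom \<Rightarrow> nat \<Rightarrow> nat \<Rightarrow> nat" where
  "pi_sequence \<pi> n d = Max {k. \<exists>f g. f \<in> Int_mats n \<and>
     Polynomial.degree f = d \<and> lowest_terms \<pi> f g k}"

definition Phi :: "nat \<Rightarrow> nat \<Rightarrow> 'v::comm_ring_1 poly" where
  "Phi q n = (\<Prod>i=1..n. Polynomial.monom 1 (q ^ i) - Polynomial.monom 1 1)"

end

theory Submission
  imports Defs "Jordan_Normal_Form.Char_Poly"
begin

text \<open>
  Let \<open>k = V/\<pi>V\<close>, a field with \<open>q\<close> elements, let \<open>\<Phi> = \<Phi>\<^bsub>q,n\<^esub>\<close> and \<open>D = deg \<Phi>\<close>.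

  Over \<open>k\<close>, the polynomial \<open>x^(q^i) - x\<close> is squarefree and its prime factors are the primes whose
  degree divides \<open>i\<close>.  Hence a prime of degree \<open>m\<close> occurs in \<open>\<Phi>\<close> with multiplicity \<open>\<lfloor>n/m\<rfloor>\<close>
  (\<open>multiplicity_Phi\<close>), which is the largest multiplicity it can have in a nonzero polynomial of
  degree at most \<open>n\<close>.  Both bounds rest on this.

  Lower bound.  Every matrix \<open>A\<close> over \<open>k\<close> is annihilated by \<open>\<Phi>\<close>, because each vector is annihilated by
  some nonzero polynomial in \<open>A\<close> of degree at most \<open>n\<close>, and such a polynomial divides \<open>\<Phi>\<close>
  (\<open>eval_Phi_mat_eq_0\<close>).  So \<open>\<Phi>/\<pi>\<close> is integer-valued on \<open>M\<^sub>n(V)\<close>, and so are the polynomials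
  \<open>x^r \<Phi>^j/\<pi>^j\<close>, of degree \<open>jD + r\<close>.

  Upper bound.  Let \<open>g/\<pi>^j\<close> be integer-valued and in lowest terms.  Evaluation at companion matrices
  shows that every monic \<open>F\<close> of degree \<open>n\<close> divides \<open>g\<close> modulo \<open>\<pi>^j\<close>.  Fix a monic \<open>A\<close> of degree \<open>n\<close> and
  divide \<open>g\<close> in turn by polynomials \<open>A + \<pi>c\<close>, where the \<open>c\<close> are constants in distinct residue classes.
  Since \<open>A + \<pi>c\<close> is congruent to the multiple \<open>\<pi>(c - c')\<close> of \<open>\<pi>\<close> modulo \<open>A + \<pi>c'\<close>, each division
  lowers the exponent of \<open>\<pi>\<close> by one and the quotient stays divisible by the remaining \<open>A + \<pi>c'\<close>
  (\<open>successive_division\<close>).  There are \<open>q\<close> constants to use, so for \<open>j \<le> q\<close> the reduction of \<open>g\<close> is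
  divisible by \<open>A^j\<close> modulo \<open>\<pi>\<close>.  Letting \<open>A\<close> lift a multiple of the power \<open>P^\<lfloor>n/deg P\<rfloor>\<close> of a prime \<open>P\<close> gives
  \<open>\<Phi>^j\<close> as a divisor, so \<open>deg g \<ge> jD\<close>.

  What remains is to exclude the exponent \<open>q + 1\<close> in degree \<open>qD\<close>.  The constants are then used up, but
  as \<open>n \<ge> 2\<close> the polynomial \<open>A + \<pi>(c + x)\<close> with \<open>A = x^n\<close> is still monic of degree \<open>n\<close>, and it
  yields one further factor \<open>x\<close> (\<open>X_power_dvd_red_poly\<close>): the reduction of \<open>g\<close> is divisible by \<open>x \<Phi>^q\<close>, which
  has degree \<open>qD + 1\<close>.  For \<open>n = 1\<close> this step breaks down, and the formula does fail at \<open>d = q^2\<close>.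
\<close>

section \<open>The residue field as a type\<close>

lemma carrier_type_ring: "carrier (type_ring :: 'v::idom ring) = UNIV"
  by (simp add: ring_of_type_algebra_def)

lemma ideal_type_ring_iff:
  fixes J :: "'v::idom set"
  shows "ideal J (type_ring :: 'v ring) \<longleftrightarrow>
    0 \<in> J \<and> (\<forall>a\<in>J. \<forall>b\<in>J. a + b \<in> J) \<and> (\<forall>a\<in>J. \<forall>r. r * a \<in> J)"
    (is "?L = ?R")
proof
  let ?T = "type_ring :: 'v ring"
  assume L: ?L
  then interpret ideal J ?T .
  show ?R
  proof (intro conjI ballI allI)
    show "0 \<in> J" using additive_subgroup.zero_closed[OF ideal.axioms(1)[OF L]] by (simp add: ring_of_type_algebra_def)
    show "a + b \<in> J" if "a \<in> J" "b \<in> J" for a b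
      using additive_subgroup.a_closed[OF ideal.axioms(1)[OF L] that]
      by (simp add: ring_of_type_algebra_def)
    show "r * a \<in> J" if "a \<in> J" for a r
      using I_l_closed[OF that, of r] by (simp add: ring_of_type_algebra_def)
  qed
next
  let ?T = "type_ring :: 'v ring"
  assume R: ?R
  interpret cring ?T by (rule cring_from_type_algebra)
  have minus: "- a \<in> J" if "a \<in> J" for a
    using R that by (metis mult_minus1)
  have inv: "inv\<^bsub>add_monoid ?T\<^esub> a = - a" for a
    using minus_equality[of "- a" a]
    by (simp add: a_inv_def ring_of_type_algebra_def)
  have "subgroup J (add_monoid ?T)"
  proof (rule subgroup.intro)
    show "inv\<^bsub>add_monoid ?T\<^esub> a \<in> J" if "a \<in> J" for a
      unfolding inv using minus[OF that] .
  qed (use R in \<open>auto simp: ring_of_type_algebra_def\<close>)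
  then show ?L
    using R by (intro idealI ring_axioms)
      (auto simp: ring_of_type_algebra_def mult.commute)
qed

text \<open>
  Zorn's lemma, applied to the ideals that do not contain \<open>1\<close>.
\<close>

lemma maximalideal_exists: "\<exists>M. maximalideal M (type_ring :: 'v::idom ring)"
proof -
  let ?T = "type_ring :: 'v ring"
  interpret cring ?T by (rule cring_from_type_algebra)
  define S where "S = {I. ideal I ?T \<and> (1::'v) \<notin> I}"
  have "\<exists>M\<in>S. \<forall>I\<in>S. M \<subseteq> I \<longrightarrow> I = M"
  proof (rule subset_Zorn)
    fix C assume C: "subset.chain S C"
    show "\<exists>U\<in>S. \<forall>I\<in>C. I \<subseteq> U"
    proof (cases "C = {}")
      case True
      have "{0} \<in> S" by (auto simp: S_def ideal_type_ring_iff)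
      then show ?thesis using True by auto
    next
      case False
      have "subset.chain {I. ideal I ?T} C"
        using C by (auto simp: pred_on.chain_def S_def)
      from chain_Union_is_ideal[OF this] False have "ideal (\<Union>C) ?T" by simp
      moreover have "1 \<notin> \<Union>C" using C by (auto simp: pred_on.chain_def S_def)
      ultimately show ?thesis by (intro bexI[of _ "\<Union>C"]) (auto simp: S_def)
    qed
  qed
  then obtain M where M: "M \<in> S" "\<And>I. I \<in> S \<Longrightarrow> M \<subseteq> I \<Longrightarrow> I = M" by blast
  have "maximalideal M ?T"
  proof (rule maximalidealI)
    show "ideal M ?T" using M by (simp add: S_def)
    show "carrier ?T \<noteq> M" using M by (auto simp: S_def carrier_type_ring)
  next
    fix J assume J: "ideal J ?T" "M \<subseteq> J" "J \<subseteq> carrier ?T"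
    show "J = M \<or> J = carrier ?T"
    proof (cases "1 \<in> J")
      case True
      then have "J = UNIV"
        using J(1) unfolding ideal_type_ring_iff by (metis UNIV_eq_I mult.right_neutral)
      then show ?thesis by (simp add: carrier_type_ring)
    next
      case False
      then show ?thesis using M J by (auto simp: S_def)
    qed
  qed
  then show ?thesis ..
qed

text \<open>
  The factorization theory of polynomials over \<open>V/\<pi>V\<close> needs a type of class \<^class>\<open>field\<close>, and a type
  cannot depend on \<open>\<pi>\<close>.  It can depend on \<open>V\<close>, though, and a maximal ideal that is chosen once and for all
  is the right one as soon as \<open>V\<close> has only one.
\<close>

definition max_ideal :: "'v::idom set" where
  "max_ideal = (SOME M. maximalideal M (type_ring :: 'v ring))"

lemma maximalideal_max_ideal: "maximalideal max_ideal (type_ring :: 'v::idom ring)"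
  unfolding max_ideal_def by (rule someI_ex[OF maximalideal_exists])

lemma max_ideal_zero: "0 \<in> max_ideal"
  and max_ideal_add: "a \<in> max_ideal \<Longrightarrow> b \<in> max_ideal \<Longrightarrow> a + b \<in> max_ideal"
  and max_ideal_mult: "a \<in> max_ideal \<Longrightarrow> r * a \<in> max_ideal"
  using maximalideal_max_ideal[THEN maximalideal.axioms(1)]
  by (auto simp: ideal_type_ring_iff)

lemma max_ideal_minus: "a \<in> max_ideal \<Longrightarrow> - a \<in> max_ideal"
  using max_ideal_mult[of a "-1"] by simp

lemma one_notin_max_ideal: "(1 :: 'v::idom) \<notin> max_ideal"
proof
  assume "(1 :: 'v) \<in> max_ideal"
  then have "(max_ideal :: 'v set) = UNIV"
    using max_ideal_mult[of 1] by auto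
  then show False
    using maximalideal.I_notcarr[OF maximalideal_max_ideal] by (metis carrier_type_ring)
qed

text \<open>
  The ideal generated by the maximal ideal and \<open>a\<close> is the whole ring.
\<close>

lemma max_ideal_inverse:
  fixes a :: "'v::idom"
  assumes "a \<notin> max_ideal"
  shows "\<exists>b. a * b - 1 \<in> max_ideal"
proof -
  define J where "J = {m + r * a | m r. m \<in> max_ideal}"
  have sub: "max_ideal \<subseteq> J"
    unfolding J_def by (force intro: exI[of _ 0])
  have "ideal J (type_ring :: 'v ring)"
    unfolding ideal_type_ring_iff
  proof (intro conjI ballI allI)
    show "0 \<in> J" using sub max_ideal_zero by auto
  next
    fix x y assume "x \<in> J" "y \<in> J"
    then obtain m r m' r' where "x = m + r * a" "y = m' + r' * a" "m \<in> max_ideal" "m' \<in> max_ideal"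
      by (auto simp: J_def)
    then show "x + y \<in> J"
      unfolding J_def by (intro CollectI exI[of _ "m + m'"] exI[of _ "r + r'"])
        (auto simp: algebra_simps max_ideal_add)
  next
    fix x s assume "x \<in> J"
    then obtain m r where "x = m + r * a" "m \<in> max_ideal" by (auto simp: J_def)
    then show "s * x \<in> J"
      unfolding J_def by (intro CollectI exI[of _ "s * m"] exI[of _ "s * r"])
        (auto simp: distrib_left mult.assoc max_ideal_mult)
  qed
  moreover have "a \<in> J"
    unfolding J_def by (intro CollectI exI[of _ 0] exI[of _ 1]) (auto simp: max_ideal_zero)
  ultimately have "J = UNIV"
    using maximalideal.I_maximal[OF maximalideal_max_ideal, of J] sub assms
    by (auto simp: carrier_type_ring)
  then have "1 \<in> J" by simp
  then obtain m r where "1 = m + r * a" "m \<in> max_ideal" unfolding J_def by blast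
  then have "a * r - 1 = - m" by (simp add: algebra_simps)
  then show ?thesis using \<open>m \<in> max_ideal\<close> max_ideal_minus by metis
qed

quotient_type (overloaded) 'v resid = "'v::idom" / "\<lambda>a b. a - b \<in> max_ideal"
  morphisms rep_resid red
proof (rule equivpI)
  show "reflp (\<lambda>a b :: 'v. a - b \<in> max_ideal)"
    by (auto intro: reflpI simp: max_ideal_zero)
  show "symp (\<lambda>a b :: 'v. a - b \<in> max_ideal)"
    by (rule sympI) (metis max_ideal_minus minus_diff_eq)
  show "transp (\<lambda>a b :: 'v. a - b \<in> max_ideal)"
    by (rule transpI) (metis max_ideal_add diff_add_cancel add_diff_eq)
qed

lemma max_ideal_inverse_unique:
  assumes "a - a' \<in> max_ideal" "a * b - 1 \<in> max_ideal" "a' * b' - 1 \<in> max_ideal"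
  shows "b - b' \<in> max_ideal"
proof -
  have "b - b' = b * (-(a' * b' - 1)) + (b' * (a * b - 1) + (b * b') * (-(a - a')))"
    by (simp add: algebra_simps)
  then show ?thesis
    using assms by (metis max_ideal_add max_ideal_mult max_ideal_minus)
qed

instantiation resid :: (idom) field
begin

lift_definition zero_resid :: "'a resid" is 0 .
lift_definition one_resid :: "'a resid" is 1 .
lift_definition plus_resid :: "'a resid \<Rightarrow> 'a resid \<Rightarrow> 'a resid" is "(+)"
  by (metis max_ideal_add add_diff_add)
lift_definition uminus_resid :: "'a resid \<Rightarrow> 'a resid" is "uminus"
  by (metis max_ideal_minus minus_diff_minus)
lift_definition minus_resid :: "'a resid \<Rightarrow> 'a resid \<Rightarrow> 'a resid" is "(-)"
proof -
  fix a a' b b' :: 'a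
  assume *: "a - a' \<in> max_ideal" "b - b' \<in> max_ideal"
  have "a - b - (a' - b') = (a - a') + - (b - b')" by simp
  then show "a - b - (a' - b') \<in> max_ideal"
    using * by (simp only: max_ideal_add max_ideal_minus)
qed
lift_definition times_resid :: "'a resid \<Rightarrow> 'a resid \<Rightarrow> 'a resid" is "(*)"
proof -
  fix a a' b b' :: 'a
  assume *: "a - a' \<in> max_ideal" "b - b' \<in> max_ideal"
  have "a * b - a' * b' = b * (a - a') + a' * (b - b')" by (simp add: algebra_simps)
  then show "a * b - a' * b' \<in> max_ideal" using * by (metis max_ideal_add max_ideal_mult)
qed
lift_definition inverse_resid :: "'a resid \<Rightarrow> 'a resid" is
  "\<lambda>a. if a \<in> max_ideal then 0 else SOME b. a * b - 1 \<in> max_ideal"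
proof -
  fix a a' :: 'a
  assume *: "a - a' \<in> max_ideal"
  have iff: "a \<in> max_ideal \<longleftrightarrow> a' \<in> max_ideal"
  proof
    assume "a \<in> max_ideal"
    from max_ideal_add[OF this max_ideal_minus[OF *]] show "a' \<in> max_ideal" by simp
  next
    assume "a' \<in> max_ideal"
    from max_ideal_add[OF this *] show "a \<in> max_ideal" by simp
  qed
  show "(if a \<in> max_ideal then 0 else SOME b. a * b - 1 \<in> max_ideal) -
    (if a' \<in> max_ideal then 0 else SOME b. a' * b - 1 \<in> max_ideal) \<in> max_ideal"
  proof (cases "a \<in> max_ideal")
    case True
    then show ?thesis using iff by (simp add: max_ideal_zero)
  next
    case False
    then have "a' \<notin> max_ideal" using iff by simp
    with False show ?thesis
      using max_ideal_inverse_unique[OF * someI_ex[OF max_ideal_inverse] someI_ex[OF max_ideal_inverse]]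
      by simp
  qed
qed
definition divide_resid :: "'a resid \<Rightarrow> 'a resid \<Rightarrow> 'a resid" where
  "divide_resid a b = a * inverse b"

instance
proof
  fix a b c :: "'a resid"
  show "a * b * c = a * (b * c)" "a * b = b * a" "1 * a = a" "a + b + c = a + (b + c)"
    "a + b = b + a" "0 + a = a" "- a + a = 0" "a - b = a + - b" "(a + b) * c = a * c + b * c"
    by (transfer; simp add: algebra_simps max_ideal_zero)+
  show "(0 :: 'a resid) \<noteq> 1"
    by transfer (metis one_notin_max_ideal max_ideal_minus diff_0 minus_minus)
  show "inverse a * a = 1" if "a \<noteq> 0"
    using that by transfer (auto simp: mult.commute intro: someI_ex[OF max_ideal_inverse])
  show "a div b = a * inverse b" by (simp add: divide_resid_def)
  show "inverse (0 :: 'a resid) = 0" by transfer (auto simp: max_ideal_zero)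
qed

end

text \<open>
  Class \<^class>\<open>field_gcd\<close> is what makes polynomials over a field a factorial ring with multiplicities.
  The operations are the trivial ones that every field has.
\<close>

instantiation resid :: (idom)
  "{unique_euclidean_ring, normalization_euclidean_semiring, normalization_semidom_multiplicative}"
begin

definition [simp]: "normalize_resid = (normalize_field :: 'a resid \<Rightarrow> _)"
definition [simp]: "unit_factor_resid = (unit_factor_field :: 'a resid \<Rightarrow> _)"
definition [simp]: "modulo_resid = (mod_field :: 'a resid \<Rightarrow> _)"
definition [simp]: "euclidean_size_resid = (euclidean_size_field :: 'a resid \<Rightarrow> _)"
definition [simp]: "division_segment (x :: 'a resid) = 1"

instance
  by standard (simp_all add: dvd_field_iff field_split_simps split: if_splits)

end

instantiation resid :: (idom) euclidean_ring_gcd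
begin

definition gcd_resid :: "'a resid \<Rightarrow> 'a resid \<Rightarrow> 'a resid" where
  "gcd_resid = Euclidean_Algorithm.gcd"
definition lcm_resid :: "'a resid \<Rightarrow> 'a resid \<Rightarrow> 'a resid" where
  "lcm_resid = Euclidean_Algorithm.lcm"
definition Gcd_resid :: "'a resid set \<Rightarrow> 'a resid" where
 "Gcd_resid = Euclidean_Algorithm.Gcd"
definition Lcm_resid :: "'a resid set \<Rightarrow> 'a resid" where
 "Lcm_resid = Euclidean_Algorithm.Lcm"

instance
  by standard (simp_all add: gcd_resid_def lcm_resid_def Gcd_resid_def Lcm_resid_def)

end

instance resid :: (idom) field_gcd ..

lemma red_eq_iff: "red a = red b \<longleftrightarrow> a - b \<in> max_ideal"
  by transfer simp

interpretation red_hom: comm_ring_hom "red :: 'v::idom \<Rightarrow> 'v resid"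
  by unfold_locales (transfer; simp add: max_ideal_zero)+

lemma surj_red: "surj red"
proof -
  have "\<exists>a. red a = x" for x :: "'a resid"
    by transfer (metis max_ideal_zero diff_self)
  then show ?thesis by (metis surjI)
qed

lemma red_eq_0_iff: "red a = 0 \<longleftrightarrow> a \<in> max_ideal"
  using red_eq_iff[of a 0] by simp

text \<open>
  For a discrete valuation ring the arbitrary choice in \<open>max_ideal\<close> is no choice.
\<close>

lemma max_ideal_eqI:
  assumes "discrete_valuation_ring (type_ring :: 'v::idom ring)"
    and "maximalideal M (type_ring :: 'v ring)"
  shows "max_ideal = M"
  using assms maximalideal_max_ideal by (auto simp: discrete_valuation_ring_def)

lemma PIdl_type_ring: "PIdl\<^bsub>type_ring\<^esub> p = {a :: 'v::idom. p dvd a}"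
  by (auto simp: cgenideal_def ring_of_type_algebra_def mult.commute elim: dvdE)

text \<open>
  Links the cardinality of the quotient record to that of the type \<open>'v resid\<close>: a coset is sent to the
  class of any of its elements.
\<close>

lemma bij_betw_quotient_resid:
  "bij_betw (\<lambda>C. red (SOME a. a \<in> C)) (carrier (type_ring Quot max_ideal)) (UNIV :: 'v::idom resid set)"
proof -
  let ?T = "type_ring :: 'v ring"
  have mem: "b \<in> max_ideal +>\<^bsub>?T\<^esub> a \<longleftrightarrow> red b = red a" for a b
    unfolding a_r_coset_def' red_eq_iff
    by (auto simp: ring_of_type_algebra_def) (metis diff_add_cancel)
  have some: "red (SOME b. b \<in> max_ideal +>\<^bsub>?T\<^esub> a) = red a" for a
    using someI[of "\<lambda>b. b \<in> max_ideal +>\<^bsub>?T\<^esub> a" a] mem by blast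
  have carr: "carrier (?T Quot max_ideal) = range (\<lambda>a. max_ideal +>\<^bsub>?T\<^esub> a)"
    by (auto simp: FactRing_def A_RCOSETS_def' carrier_type_ring)
  have "max_ideal +>\<^bsub>?T\<^esub> a = max_ideal +>\<^bsub>?T\<^esub> b" if "red a = red b" for a b
    using that by (auto simp: mem)
  then have "inj_on (\<lambda>C. red (SOME a. a \<in> C)) (carrier (?T Quot max_ideal))"
    unfolding carr inj_on_def ball_simps some by blast
  moreover have "(\<lambda>C. red (SOME a. a \<in> C)) ` carrier (?T Quot max_ideal) = UNIV"
    unfolding carr image_image some using surj_red .
  ultimately show ?thesis by (simp add: bij_betw_def)
qed

section \<open>Primes dividing \<open>x^(q^i) - x\<close> over a finite field\<close>

definition polys_below :: "nat \<Rightarrow> 'a::zero poly set" where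
  "polys_below m = {p. \<forall>i\<ge>m. coeff p i = 0}"

lemma polys_below_iff: "p \<in> polys_below m \<longleftrightarrow> p = 0 \<or> degree p < m"
proof
  assume "p \<in> polys_below m"
  then show "p = 0 \<or> degree p < m"
    using leading_coeff_neq_0[of p] by (fastforce simp: polys_below_def)
next
  assume "p = 0 \<or> degree p < m"
  then show "p \<in> polys_below m"
    by (auto simp: polys_below_def intro: coeff_eq_0)
qed

lemma polys_below_Suc:
  "polys_below (Suc m) = (case_prod pCons ` (UNIV \<times> polys_below m) :: 'a::zero poly set)"
proof safe
  fix p :: "'a poly"
  assume p: "p \<in> polys_below (Suc m)"
  obtain a r where r: "p = pCons a r" by (cases p)
  have "coeff r i = 0" if "i \<ge> m" for i
    using p that unfolding polys_below_def r by (metis (mono_tags, lifting) Suc_le_mono coeff_pCons_Suc mem_Collect_eq)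
  then have "r \<in> polys_below m"
    by (simp add: polys_below_def)
  with r show "p \<in> case_prod pCons ` (UNIV \<times> polys_below m)" by auto
next
  fix a :: 'a and p :: "'a poly" assume "p \<in> polys_below m"
  then show "pCons a p \<in> polys_below (Suc m)"
    by (auto simp: polys_below_def coeff_pCons split: nat.split)
qed

lemma finite_polys_below:
  assumes "finite (UNIV :: 'a::zero set)"
  shows "finite (polys_below m :: 'a poly set)"
proof (induction m)
  case 0
  have "polys_below 0 = {0 :: 'a poly}" by (auto simp: polys_below_iff)
  then show ?case by simp
qed (use assms in \<open>auto simp: polys_below_Suc\<close>)

lemma card_polys_below:
  "card (polys_below m :: 'a::zero poly set) = card (UNIV :: 'a set) ^ m"
proof (induction m)
  case 0
  have "polys_below 0 = {0 :: 'a poly}" by (auto simp: polys_below_iff)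
  then show ?case by simp
next
  case (Suc m)
  have "inj_on (case_prod pCons) (UNIV \<times> polys_below m :: ('a \<times> 'a poly) set)"
    by (auto simp: inj_on_def)
  then show ?case
    by (simp add: polys_below_Suc card_image card_cartesian_product Suc)
qed

lemma prime_elem_not_dvd_polys_below:
  fixes P :: "'k::field_gcd poly"
  assumes "r \<in> polys_below (degree P)" "r \<noteq> 0"
  shows "\<not> P dvd r"
  using assms by (auto simp: polys_below_iff dest: dvd_imp_degree_le)

text \<open>
  Fermat's little theorem in the field \<open>k[x]/(P)\<close>, which has \<open>q^deg P\<close> elements.  Its elements
  are represented by the polynomials of degree less than \<open>deg P\<close>; multiplication by a unit \<open>c\<close>
  permutes the nonzero ones, and comparing their products gives \<open>c^(q^deg P - 1) = 1\<close>.
\<close>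

lemma fermat_mod_prime:
  fixes P :: "'k::field_gcd poly"
  assumes fin: "finite (UNIV :: 'k set)" and P: "prime_elem P"
  shows "P dvd c ^ (card (UNIV :: 'k set) ^ degree P) - c"
proof (cases "P dvd c")
  case True
  have "card (UNIV :: 'k set) ^ degree P > 0" using fin by (simp add: finite_UNIV_card_ge_0)
  then have "c dvd c ^ (card (UNIV :: 'k set) ^ degree P)" by (simp add: dvd_power)
  with True show ?thesis by (meson dvd_diff dvd_trans)
next
  case False
  define A where "A = polys_below (degree P) - {0 :: 'k poly}"
  define f where "f r = (c * r) mod P" for r
  have "P \<noteq> 0" using P by auto
  have finA: "finite A" using finite_polys_below[OF fin] by (simp add: A_def)
  have "0 \<in> (polys_below (degree P) :: 'k poly set)" by (simp add: polys_below_iff)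
  then have cardA: "Suc (card A) = card (UNIV :: 'k set) ^ degree P"
    using card_Suc_Diff1[OF finite_polys_below[OF fin]] unfolding A_def card_polys_below[symmetric] by metis
  have ndvd: "\<not> P dvd r" if "r \<in> A" for r
    using that prime_elem_not_dvd_polys_below by (auto simp: A_def)
  have fA: "f ` A \<subseteq> A"
  proof safe
    fix r assume "r \<in> A"
    then have "\<not> P dvd c * r" using ndvd False P prime_elem_dvd_multD by blast
    then have "f r \<noteq> 0" by (simp add: f_def mod_eq_0_iff_dvd)
    then show "f r \<in> A"
      using degree_mod_less'[OF \<open>P \<noteq> 0\<close>] by (auto simp: A_def polys_below_iff f_def)
  qed
  have "inj_on f A"
  proof (rule inj_onI)
    fix r s assume rs: "r \<in> A" "s \<in> A" "f r = f s"
    then have "P dvd c * r - c * s" by (simp add: f_def mod_eq_dvd_iff)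
    then have "P dvd r - s"
      using False P prime_elem_dvd_multD by (metis right_diff_distrib)
    moreover have "r - s \<in> polys_below (degree P)"
      using rs by (auto simp: A_def polys_below_def)
    ultimately show "r = s" using prime_elem_not_dvd_polys_below by fastforce
  qed
  then have "bij_betw f A A"
    using fA finA by (simp add: bij_betw_def endo_inj_surj)
  then have "prod f A = \<Prod>A"
    using prod.reindex_bij_betw[of f A A "\<lambda>x. x"] by simp
  then have "(\<Prod>r\<in>A. c * r) mod P = \<Prod>A mod P"
    using mod_prod_eq[of "\<lambda>r. c * r" P A] by (simp add: f_def)
  then have "P dvd c ^ card A * \<Prod>A - \<Prod>A"
    by (simp add: prod.distrib mod_eq_dvd_iff)
  then have "P dvd (c ^ card A - 1) * \<Prod>A" by (simp add: algebra_simps)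
  moreover have "\<not> P dvd \<Prod>A"
    using finA ndvd
  proof (induction A rule: finite_induct)
    case empty
    then show ?case using P by (auto simp: prime_elem_def)
  next
    case (insert x F)
    then show ?case using P by (auto simp: prime_elem_dvd_mult_iff)
  qed
  ultimately have "P dvd c ^ card A - 1" using P prime_elem_dvd_multD by blast
  then have "P dvd (c ^ card A - 1) * c" by simp
  then show ?thesis by (simp add: cardA[symmetric] algebra_simps)
qed

text \<open>
  The case \<open>P = x\<close>, where \<open>k[x]/(P)\<close> is \<open>k\<close> itself.
\<close>

lemma power_card_field_eq:
  fixes a :: "'k::field_gcd"
  assumes fin: "finite (UNIV :: 'k set)"
  shows "a ^ card (UNIV :: 'k set) = a"
proof -
  have "prime_elem [:0, 1 :: 'k:]" by (rule prime_elem_linear_field_poly) simp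
  from fermat_mod_prime[OF fin this, of "[:a:]"]
  have "[:0, 1:] dvd [:a ^ card (UNIV :: 'k set) - a:]"
    by (simp add: poly_const_pow diff_to_poly)
  from dvd_imp_degree_le[OF this] show ?thesis by auto
qed

lemma card_field_gt_1:
  assumes "finite (UNIV :: 'k::field set)"
  shows "card (UNIV :: 'k set) > 1"
proof -
  have "card {0, 1 :: 'k} \<le> card (UNIV :: 'k set)" by (rule card_mono[OF assms]) auto
  then show ?thesis by simp
qed

text \<open>
  The polynomial \<open>(x + 1)^q - x^q - 1\<close> has degree less than \<open>q\<close> and vanishes at all \<open>q\<close> elements of the field,
  so it is zero; its coefficients are these binomial coefficients.
\<close>

lemma of_nat_card_choose_eq_0:
  assumes fin: "finite (UNIV :: 'k::field_gcd set)" and j: "0 < j" "j < card (UNIV :: 'k set)"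
  shows "of_nat (card (UNIV :: 'k set) choose j) = (0 :: 'k)"
proof -
  define q where "q = card (UNIV :: 'k set)"
  define h :: "'k poly" where "h = [:1, 1:] ^ q - monom 1 q - 1"
  have "poly h x = 0" for x
    using power_card_field_eq[OF fin] by (simp add: h_def poly_monom q_def)
  moreover have "degree h < q"
  proof -
    have q1: "q > 1" using card_field_gt_1[OF fin] by (simp add: q_def)
    have "coeff h i = 0" if "i \<ge> q" for i
    proof (cases "i = q")
      case True
      then show ?thesis using q1 by (simp add: h_def coeff_linear_power)
    next
      case False
      have "degree ([:1, 1 :: 'k:] ^ q) \<le> q" by (simp add: degree_linear_power)
      then show ?thesis using False that q1 by (simp add: h_def coeff_eq_0)
    qed
    then have "h \<in> polys_below q" by (simp add: polys_below_def)
    then show ?thesis using q1 by (auto simp: polys_below_iff)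
  qed
  ultimately have "h = 0"
    using card_poly_roots_bound[of h] by (auto simp: q_def)
  then have "coeff h j = 0" by simp
  then show ?thesis
    using j by (simp add: h_def q_def coeff_linear_poly_power)
qed

lemma of_nat_card_field_eq_0:
  assumes "finite (UNIV :: 'k::field_gcd set)"
  shows "of_nat (card (UNIV :: 'k set)) = (0 :: 'k)"
  using of_nat_card_choose_eq_0[OF assms, of 1] card_field_gt_1[OF assms] by simp

lemma frobenius_add:
  fixes f g :: "'k::field_gcd poly"
  assumes fin: "finite (UNIV :: 'k set)"
  shows "(f + g) ^ (card (UNIV :: 'k set) ^ r) = f ^ (card (UNIV :: 'k set) ^ r) + g ^ (card (UNIV :: 'k set) ^ r)"
proof (induction r)
  case (Suc r)
  define q where "q = card (UNIV :: 'k set)"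
  have q1: "q > 1" using card_field_gt_1[OF fin] by (simp add: q_def)
  have step: "(u + v) ^ q = u ^ q + v ^ q" for u v :: "'k poly"
  proof -
    have "(u + v) ^ q = (\<Sum>j\<le>q. of_nat (q choose j) * u ^ j * v ^ (q - j))"
      by (rule binomial_ring)
    also have "\<dots> = (\<Sum>j\<in>{0, q}. of_nat (q choose j) * u ^ j * v ^ (q - j))"
    proof (rule sum.mono_neutral_right)
      show "\<forall>j\<in>{..q} - {0, q}. of_nat (q choose j) * u ^ j * v ^ (q - j) = 0"
        using of_nat_card_choose_eq_0[OF fin] by (auto simp: q_def of_nat_poly)
    qed auto
    also have "\<dots> = u ^ q + v ^ q" using q1 by (simp add: add.commute)
    finally show ?thesis .
  qed
  show ?case
    using Suc unfolding q_def[symmetric] power_Suc2 power_mult by (simp add: step)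
qed simp

text \<open>
  Because \<open>R/(p)\<close> is a domain, a root \<open>a\<close> can be split off as a factor \<open>t - a\<close>.  Congruences in \<open>R\<close> stand in
  for the quotient, which is not a type.
\<close>

lemma card_roots_mod_prime_le:
  fixes f :: "'r::idom poly"
  assumes p: "prime_elem p"
    and "\<not> p dvd lead_coeff f" "finite S" "\<And>s. s \<in> S \<Longrightarrow> p dvd poly f s"
    and "\<And>s t. s \<in> S \<Longrightarrow> t \<in> S \<Longrightarrow> s \<noteq> t \<Longrightarrow> \<not> p dvd s - t"
  shows "card S \<le> degree f"
  using assms(2-)
proof (induction "degree f" arbitrary: f S)
  case 0
  have "S = {}"
  proof (rule ccontr)
    assume "S \<noteq> {}"
    then obtain s where "p dvd poly f s" using 0 by auto
    then show False using 0 by (metis degree_0_id poly_const_conv)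
  qed
  then show ?case by simp
next
  case (Suc n)
  show ?case
  proof (cases "S = {}")
    case False
    then obtain a where a: "a \<in> S" by auto
    have "poly (f - [:poly f a:]) a = 0" by simp
    then obtain g where g: "f - [:poly f a:] = [:- a, 1:] * g"
      unfolding poly_eq_0_iff_dvd by (auto elim: dvdE)
    have "degree (f - [:poly f a:]) = Suc n"
      using Suc.hyps(2) by (simp add: diff_conv_add_uminus degree_add_eq_left del: add_uminus_conv_diff)
    moreover have "g \<noteq> 0" using calculation g by auto
    ultimately have deg_g: "degree g = n" by (simp add: g degree_mult_eq del: mult_pCons_left)
    have "lead_coeff ([:- a, 1:] * g) = lead_coeff g" by (simp only: lead_coeff_mult) simp
    moreover have "lead_coeff (f - [:poly f a:]) = lead_coeff f"
      using \<open>degree (f - [:poly f a:]) = Suc n\<close> Suc.hyps(2) by (simp add: coeff_pCons split: nat.split)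
    ultimately have lc: "lead_coeff g = lead_coeff f" using g by simp
    have "p dvd poly g s" if s: "s \<in> S - {a}" for s
    proof -
      have "poly f s - poly f a = (s - a) * poly g s"
        using arg_cong[OF g, of "\<lambda>h. poly h s"] by (simp add: algebra_simps)
      then have "p dvd (s - a) * poly g s"
        using Suc.prems(3) a s by (metis Diff_iff dvd_diff)
      then show ?thesis using p s a Suc.prems(4)[of s a] by (auto dest: prime_elem_dvd_multD)
    qed
    then have "card (S - {a}) \<le> degree g"
      using Suc.prems lc deg_g by (intro Suc.hyps(1)) auto
    then show ?thesis using a Suc.prems(2) Suc.hyps(2) deg_g by (simp add: card_Diff_singleton)
  qed simp
qed

text \<open>
  The \<open>N\<close>-th power map is a ring endomorphism that fixes the constants, so modulo \<open>P\<close> it is the identity once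
  it fixes \<open>x\<close>.
\<close>

lemma power_eq_self_mod_if_X:
  fixes P :: "'k::field_gcd poly"
  assumes fin: "finite (UNIV :: 'k set)"
    and N: "N = card (UNIV :: 'k set) ^ r" and P: "P dvd monom 1 N - monom 1 1"
  shows "P dvd c ^ N - c"
proof (induction c rule: pCons_induct)
  case 0
  then show ?case using card_field_gt_1[OF fin] by (simp add: N zero_power)
next
  case (pCons a c)
  have aN: "a ^ N = a" for a :: 'k
    unfolding N by (induction r) (simp_all add: power_mult power_card_field_eq[OF fin])
  have eq: "pCons a c = [:a:] + monom 1 1 * c"
    by (simp add: monom_Suc monom_0)
  have "pCons a c ^ N = [:a:] + monom 1 N * c ^ N"
    unfolding eq N frobenius_add[OF fin] unfolding N[symmetric]
    by (simp add: poly_const_pow aN power_mult_distrib monom_power)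
  then have "pCons a c ^ N - pCons a c = monom 1 N * (c ^ N - c) + (monom 1 N - monom 1 1) * c"
    unfolding eq by (simp add: algebra_simps)
  then show ?case using pCons.IH P by simp
qed

lemma fermat_mod_prime_iterated:
  fixes P :: "'k::field_gcd poly"
  assumes fin: "finite (UNIV :: 'k set)" and P: "prime_elem P"
  shows "P dvd c ^ (card (UNIV :: 'k set) ^ (degree P * t)) - c"
proof (induction t)
  case (Suc t)
  let ?q = "card (UNIV :: 'k set)"
  have "c ^ (?q ^ (degree P * Suc t)) = (c ^ (?q ^ (degree P * t))) ^ (?q ^ degree P)"
    by (simp add: power_add mult.commute flip: power_mult)
  then have "c ^ (?q ^ (degree P * Suc t)) - c =
      ((c ^ (?q ^ (degree P * t))) ^ (?q ^ degree P) - c ^ (?q ^ (degree P * t)))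
      + (c ^ (?q ^ (degree P * t)) - c)" by simp
  then show ?case using fermat_mod_prime[OF fin P] Suc by (metis dvd_add)
qed simp

text \<open>
  Let \<open>m = deg P\<close>.  If \<open>x^(q^i) = x\<close> modulo \<open>P\<close>, then \<open>i\<close> may be replaced by \<open>r = i mod m\<close>.  Then all
  \<open>q^m\<close> elements of \<open>k[x]/(P)\<close> are roots of \<open>t^(q^r) - t\<close>, and \<open>r < m\<close> forces \<open>r = 0\<close>.
\<close>

lemma prime_dvd_monom_diff_iff:
  fixes P :: "'k::field_gcd poly"
  assumes fin: "finite (UNIV :: 'k set)" and P: "prime_elem P"
  shows "P dvd monom 1 (card (UNIV :: 'k set) ^ i) - monom 1 1 \<longleftrightarrow> degree P dvd i"
proof
  let ?q = "card (UNIV :: 'k set)"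
  have q: "?q > 1" by (rule card_field_gt_1[OF fin])
  have xpow: "monom 1 1 ^ N = (monom 1 N :: 'k poly)" for N by (simp add: monom_power)
  show "P dvd monom 1 (?q ^ i) - monom 1 1" if "degree P dvd i"
    using that fermat_mod_prime_iterated[OF fin P, of "monom 1 1", unfolded xpow] by (auto elim!: dvdE)
  assume dvd: "P dvd monom 1 (?q ^ i) - monom 1 1"
  have "\<not> is_unit P" "P \<noteq> 0" using P by (auto simp: prime_elem_def)
  then have m: "degree P > 0" by (simp add: is_unit_iff_degree)
  define r where "r = i mod degree P"
  define N where "N = ?q ^ r"
  define u where "u = monom (1 :: 'k) 1 ^ (?q ^ (degree P * (i div degree P)))"
  have "i = degree P * (i div degree P) + r" by (simp add: r_def)
  then have "?q ^ i = ?q ^ (degree P * (i div degree P)) * N"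
    unfolding N_def by (metis power_add)
  then have "monom 1 (?q ^ i) = u ^ N"
    unfolding u_def by (simp add: monom_power)
  moreover have "P dvd u - monom 1 1" unfolding u_def by (rule fermat_mod_prime_iterated[OF fin P])
  then have "P dvd u ^ N - monom 1 1 ^ N"
    by (metis dvd_trans dvd_triv_left power_diff_sumr2)
  ultimately have "P dvd (monom 1 (?q ^ i) - monom 1 1) - (monom 1 (?q ^ i) - monom 1 N)"
    using dvd unfolding xpow by (metis dvd_diff)
  then have "P dvd monom 1 N - monom 1 1" by simp
  note fixed = power_eq_self_mod_if_X[OF fin N_def this]
  have "r = 0"
  proof (rule ccontr)
    assume "r \<noteq> 0"
    then have N1: "N > 1" unfolding N_def using one_less_power[OF q, of r] by simp
    \<comment> \<open>A polynomial in a new variable \<open>t\<close> with coefficients in \<open>k[x]\<close>.\<close>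
    let ?f = "monom 1 N - monom 1 1 :: 'k poly poly"
    have deg: "degree ?f = N" using N1 by (simp add: diff_conv_add_uminus degree_add_eq_left degree_monom_eq del: add_uminus_conv_diff)
    have "card (polys_below (degree P) :: 'k poly set) \<le> degree ?f"
    proof (rule card_roots_mod_prime_le[OF P])
      have "lead_coeff ?f = 1" unfolding deg using N1 by simp
      then show "\<not> P dvd lead_coeff ?f" using \<open>\<not> is_unit P\<close> by simp
      show "finite (polys_below (degree P) :: 'k poly set)" by (rule finite_polys_below[OF fin])
      show "P dvd poly ?f s" for s using fixed by (simp add: poly_monom)
      fix s t :: "'k poly"
      assume "s \<in> polys_below (degree P)" "t \<in> polys_below (degree P)" "s \<noteq> t"
      then show "\<not> P dvd s - t"
        by (intro prime_elem_not_dvd_polys_below) (auto simp: polys_below_def)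
    qed
    then have "?q ^ degree P \<le> ?q ^ r" unfolding deg card_polys_below unfolding N_def .
    then have "degree P \<le> r" by (rule power_le_imp_le_exp[OF q])
    moreover have "r < degree P" using m by (simp add: r_def)
    ultimately show False by simp
  qed
  then show "degree P dvd i" by (simp add: r_def mod_eq_0_iff_dvd)
qed

text \<open>
  Multiplicity two is impossible, because the derivative of \<open>x^(q^i) - x\<close> is \<open>-1\<close>.
\<close>

lemma multiplicity_prime_monom_diff:
  fixes P :: "'k::field_gcd poly"
  assumes fin: "finite (UNIV :: 'k set)" and P: "prime_elem P" and i: "i > 0"
  shows "multiplicity P (monom 1 (card (UNIV :: 'k set) ^ i) - monom 1 1) = (if degree P dvd i then 1 else 0)"
proof (cases "degree P dvd i")
  case True
  let ?q = "card (UNIV :: 'k set)"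
  let ?f = "monom 1 (?q ^ i) - monom 1 1 :: 'k poly"
  have unit: "\<not> is_unit P" using P by (auto simp: prime_elem_def)
  have "\<not> P ^ Suc 1 dvd ?f"
  proof
    assume "P ^ Suc 1 dvd ?f"
    then obtain h where "?f = P ^ Suc 1 * h" by (rule dvdE)
    then have h: "?f = P * (P * h)" by (simp add: mult.assoc)
    have "pderiv ?f = P * (pderiv (P * h) + pderiv P * h)"
      unfolding h by (simp add: pderiv_mult algebra_simps)
    moreover have "pderiv ?f = - 1"
      using i of_nat_card_field_eq_0[OF fin] by (simp add: pderiv_diff pderiv_monom monom_0 power_0_left one_pCons)
    ultimately have "P dvd - 1" by (metis dvd_triv_left)
    then show False using unit by simp
  qed
  moreover have "P ^ 1 dvd ?f" using True prime_dvd_monom_diff_iff[OF fin P] by simp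
  ultimately show ?thesis using True multiplicity_eqI[of P 1 ?f] by simp
next
  case False
  then show ?thesis
    using prime_dvd_monom_diff_iff[OF fin P, of i] by (simp add: not_dvd_imp_multiplicity_0)
qed

lemma sum_indicator_multiples:
  assumes "m > 0"
  shows "(\<Sum>i=1..n. if m dvd i then 1 else 0) = (n div m :: nat)"
proof (induction n)
  case (Suc n)
  then show ?case using assms
    by (simp add: div_Suc mod_eq_0_iff_dvd[symmetric])
qed simp

lemma multiplicity_Phi:
  fixes P :: "'k::field_gcd poly"
  assumes fin: "finite (UNIV :: 'k set)" and P: "prime_elem P"
  shows "multiplicity P (Phi (card (UNIV :: 'k set)) n) = n div degree P"
proof -
  let ?q = "card (UNIV :: 'k set)"
  have q: "?q > 1" by (rule card_field_gt_1[OF fin])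
  have "\<not> is_unit P" "P \<noteq> 0" using P by (auto simp: prime_elem_def)
  then have m: "degree P > 0" by (simp add: is_unit_iff_degree)
  have nz: "monom 1 (?q ^ i) - monom 1 1 \<noteq> (0 :: 'k poly)" if "i \<ge> 1" for i
    using q that by (auto simp: monom_eq_iff')
  have "multiplicity P (Phi ?q n) = (\<Sum>i=1..n. multiplicity P (monom 1 (?q ^ i) - monom 1 1))"
    unfolding Phi_def using nz by (intro prime_elem_multiplicity_prod_distrib[OF P]) auto
  also have "\<dots> = (\<Sum>i=1..n. if degree P dvd i then 1 else 0)"
    by (intro sum.cong refl multiplicity_prime_monom_diff[OF fin P]) auto
  also have "\<dots> = n div degree P" by (rule sum_indicator_multiples[OF m])
  finally show ?thesis .
qed

lemma degree_Phi_factor: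
  assumes "q > 1" "i > 0"
  shows "degree (monom 1 (q ^ i) - monom 1 1 :: 'a::comm_ring_1 poly) = q ^ i"
    and "lead_coeff (monom 1 (q ^ i) - monom 1 1 :: 'a::comm_ring_1 poly) = 1"
proof -
  have qi: "q ^ i > 1" using one_less_power[OF assms] .
  have "degree (- monom 1 1 :: 'a poly) < degree (monom 1 (q ^ i) :: 'a poly)"
    using qi by (simp add: degree_monom_eq)
  from degree_add_eq_left[OF this]
  show deg: "degree (monom 1 (q ^ i) - monom 1 1 :: 'a poly) = q ^ i"
    by (simp add: degree_monom_eq)
  show "lead_coeff (monom 1 (q ^ i) - monom 1 1 :: 'a poly) = 1"
    unfolding deg using qi by simp
qed

text \<open>
  A prime of degree \<open>m\<close> has multiplicity at most \<open>\<lfloor>n/m\<rfloor>\<close> in \<open>f\<close>.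
\<close>

lemma dvd_Phi:
  fixes f :: "'k::field_gcd poly"
  assumes fin: "finite (UNIV :: 'k set)" and f: "f \<noteq> 0" "degree f \<le> n"
  shows "f dvd Phi (card (UNIV :: 'k set)) n"
proof (rule multiplicity_le_imp_dvd[OF f(1)])
  fix P :: "'k poly" assume "prime P"
  then have P: "prime_elem P" by simp
  then have "\<not> is_unit P" "P \<noteq> 0" by (auto simp: prime_elem_def)
  then have m: "degree P > 0" by (simp add: is_unit_iff_degree)
  have "P ^ multiplicity P f dvd f" by (rule multiplicity_dvd)
  from dvd_imp_degree_le[OF this f(1)] have "multiplicity P f * degree P \<le> n"
    using f \<open>P \<noteq> 0\<close> by (simp add: degree_power_eq mult.commute)
  then show "multiplicity P f \<le> multiplicity P (Phi (card (UNIV :: 'k set)) n)"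
    using m by (simp add: multiplicity_Phi[OF fin P] less_eq_div_iff_mult_less_eq)
qed

lemma map_poly_Phi:
  fixes hom :: "'a::comm_ring_1 \<Rightarrow> 'b::comm_ring_1"
  assumes "comm_ring_hom hom"
  shows "map_poly hom (Phi q n) = Phi q n"
proof -
  interpret comm_ring_hom hom by (rule assms)
  interpret p: map_poly_comm_ring_hom hom ..
  have "map_poly hom (monom 1 m) = monom 1 m" for m by (simp add: map_poly_monom)
  then show ?thesis
    by (simp add: Phi_def p.hom_prod p.hom_minus)
qed

lemma lead_coeff_Phi:
  assumes "q > 1"
  shows "lead_coeff (Phi q n :: 'a::idom poly) = 1"
  unfolding Phi_def lead_coeff_prod
proof (intro prod.neutral ballI)
  fix i assume "i \<in> {1..n}"
  then show "lead_coeff (monom 1 (q ^ i) - monom 1 1 :: 'a poly) = 1"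
    by (intro degree_Phi_factor(2)[OF assms]) simp
qed

lemma Phi_nonzero: "q > 1 \<Longrightarrow> (Phi q n :: 'a::idom poly) \<noteq> 0"
  using lead_coeff_Phi[of q n, where ?'a = 'a] by auto

lemma degree_Phi:
  assumes "q > 1"
  shows "degree (Phi q n :: 'a::idom poly) = (\<Sum>i=1..n. q ^ i)"
proof -
  have "degree (Phi q n :: 'a poly) = (\<Sum>i=1..n. degree (monom 1 (q ^ i) - monom 1 1 :: 'a poly))"
    unfolding Phi_def
  proof (rule degree_prod_eq_sum_degree)
    show "\<forall>i\<in>{1..n}. monom 1 (q ^ i) - monom 1 1 \<noteq> (0 :: 'a poly)"
    proof (intro ballI notI)
      fix i assume i: "i \<in> {1..n}" and 0: "monom 1 (q ^ i) - monom 1 1 = (0 :: 'a poly)"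
      have "degree (monom 1 (q ^ i) - monom 1 1 :: 'a poly) = q ^ i"
        using i by (intro degree_Phi_factor(1)[OF assms]) simp
      then show False unfolding 0 using assms by simp
    qed
  qed
  also have "\<dots> = (\<Sum>i=1..n. q ^ i)"
    by (intro sum.cong refl degree_Phi_factor(1)[OF assms]) auto
  finally show ?thesis .
qed

section \<open>Evaluation of polynomials at matrices\<close>

text \<open>
  A common upper limit \<open>N\<close> of the summation makes evaluations of polynomials of different degrees comparable.
\<close>

lemma eval_poly_mat_index:
  assumes A: "A \<in> carrier_mat n n" and "i < n" "j < n" and N: "degree f \<le> N"
  shows "eval_poly_mat f A $$ (i, j) = (\<Sum>k\<le>N. coeff f k * (A ^\<^sub>m k) $$ (i, j))"
proof -
  have "eval_poly_mat f A $$ (i, j) = (\<Sum>k\<le>degree f. coeff f k * (A ^\<^sub>m k) $$ (i, j))"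
    using assms by (simp add: eval_poly_mat_def)
  also have "\<dots> = (\<Sum>k\<le>N. coeff f k * (A ^\<^sub>m k) $$ (i, j))"
    using N by (intro sum.mono_neutral_left) (auto simp: coeff_eq_0)
  finally show ?thesis .
qed

lemma eval_poly_mat_carrier:
  "A \<in> carrier_mat n n \<Longrightarrow> eval_poly_mat f A \<in> carrier_mat n n"
  by (simp add: eval_poly_mat_def)

lemma eval_poly_mat_add:
  assumes A: "A \<in> carrier_mat n n"
  shows "eval_poly_mat (f + g) A = eval_poly_mat f A + eval_poly_mat g A"
proof (rule eq_matI)
  fix i j
  assume "i < dim_row (eval_poly_mat f A + eval_poly_mat g A)"
    "j < dim_col (eval_poly_mat f A + eval_poly_mat g A)"
  then have ij: "i < n" "j < n" using A by (auto simp: eval_poly_mat_def)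
  let ?N = "max (degree f) (degree g)"
  have "degree (f + g) \<le> ?N" by (rule degree_add_le_max)
  then show "eval_poly_mat (f + g) A $$ (i, j) = (eval_poly_mat f A + eval_poly_mat g A) $$ (i, j)"
    using ij carrier_matD[OF eval_poly_mat_carrier[OF A]]
    by (simp add: eval_poly_mat_index[OF A ij, where N = ?N] algebra_simps sum.distrib)
qed (use A in \<open>auto simp: eval_poly_mat_def\<close>)

lemma eval_poly_mat_smult:
  assumes A: "A \<in> carrier_mat n n"
  shows "eval_poly_mat (smult a f) A = a \<cdot>\<^sub>m eval_poly_mat f A"
proof (rule eq_matI)
  fix i j
  assume "i < dim_row (a \<cdot>\<^sub>m eval_poly_mat f A)" "j < dim_col (a \<cdot>\<^sub>m eval_poly_mat f A)"
  then have ij: "i < n" "j < n" using A by (auto simp: eval_poly_mat_def)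
  show "eval_poly_mat (smult a f) A $$ (i, j) = (a \<cdot>\<^sub>m eval_poly_mat f A) $$ (i, j)"
    using ij carrier_matD[OF eval_poly_mat_carrier[OF A]]
    by (simp add: eval_poly_mat_index[OF A ij, where N = "degree f"] degree_smult_le sum_distrib_left mult.assoc)
qed (use A in \<open>auto simp: eval_poly_mat_def\<close>)

lemma eval_poly_mat_pCons:
  assumes A: "A \<in> carrier_mat n n"
  shows "eval_poly_mat (pCons a f) A = a \<cdot>\<^sub>m 1\<^sub>m n + eval_poly_mat f A * A"
proof (rule eq_matI)
  fix i j
  assume "i < dim_row (a \<cdot>\<^sub>m 1\<^sub>m n + eval_poly_mat f A * A)" "j < dim_col (a \<cdot>\<^sub>m 1\<^sub>m n + eval_poly_mat f A * A)"
  then have ij: "i < n" "j < n" using A by (auto simp: eval_poly_mat_def)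
  have pow: "(A ^\<^sub>m Suc k) $$ (i, j) = (\<Sum>l<n. (A ^\<^sub>m k) $$ (i, l) * A $$ (l, j))" for k
    using A ij pow_carrier_mat[OF A, of k] by (simp add: scalar_prod_def atLeast0LessThan)
  have "eval_poly_mat (pCons a f) A $$ (i, j) =
      (\<Sum>k\<le>Suc (degree f). coeff (pCons a f) k * (A ^\<^sub>m k) $$ (i, j))"
    by (rule eval_poly_mat_index[OF A ij degree_pCons_le])
  also have "\<dots> = a * (A ^\<^sub>m 0) $$ (i, j) + (\<Sum>k\<le>degree f. coeff f k * (A ^\<^sub>m Suc k) $$ (i, j))"
    by (simp only: sum.atMost_Suc_shift coeff_pCons_0 coeff_pCons_Suc)
  also have "(\<Sum>k\<le>degree f. coeff f k * (A ^\<^sub>m Suc k) $$ (i, j)) =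
      (\<Sum>l<n. (\<Sum>k\<le>degree f. coeff f k * (A ^\<^sub>m k) $$ (i, l)) * A $$ (l, j))"
    unfolding pow sum_distrib_left sum_distrib_right by (subst sum.swap) (simp add: mult.assoc)
  also have "\<dots> = (\<Sum>l<n. eval_poly_mat f A $$ (i, l) * A $$ (l, j))"
    using ij by (intro sum.cong) (auto simp: eval_poly_mat_index[OF A _ _ order_refl])
  also have "a * (A ^\<^sub>m 0) $$ (i, j) + \<dots> = (a \<cdot>\<^sub>m 1\<^sub>m n + eval_poly_mat f A * A) $$ (i, j)"
    using ij A eval_poly_mat_carrier[OF A, of f] by (simp add: scalar_prod_def atLeast0LessThan)
  finally show "eval_poly_mat (pCons a f) A $$ (i, j) = \<dots>" .
qed (use A in \<open>auto simp: eval_poly_mat_def\<close>)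

lemma eval_poly_mat_0:
  assumes A: "A \<in> carrier_mat n n"
  shows "eval_poly_mat 0 A = 0\<^sub>m n n"
  using A by (auto simp: eval_poly_mat_def)

lemma eval_poly_mat_mult:
  assumes A: "A \<in> carrier_mat n n"
  shows "eval_poly_mat (f * g) A = eval_poly_mat f A * eval_poly_mat g A"
proof (induction g rule: pCons_induct)
  case 0
  then show ?case
    using eval_poly_mat_carrier[OF A, of f] by (simp add: eval_poly_mat_0[OF A])
next
  case (pCons a g)
  note C = eval_poly_mat_carrier[OF A, of f] eval_poly_mat_carrier[OF A, of g]
  have "eval_poly_mat (f * pCons a g) A = eval_poly_mat (smult a f + pCons 0 (f * g)) A"
    by simp
  also have "\<dots> = a \<cdot>\<^sub>m eval_poly_mat f A + (0 \<cdot>\<^sub>m 1\<^sub>m n + eval_poly_mat (f * g) A * A)"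
    by (simp only: eval_poly_mat_add[OF A] eval_poly_mat_smult[OF A] eval_poly_mat_pCons[OF A])
  also have "0 \<cdot>\<^sub>m 1\<^sub>m n + eval_poly_mat (f * g) A * A = eval_poly_mat f A * (eval_poly_mat g A * A)"
    using C A unfolding pCons.IH by (auto simp: assoc_mult_mat[of _ n n _ n _ n])
  also have "a \<cdot>\<^sub>m eval_poly_mat f A = eval_poly_mat f A * (a \<cdot>\<^sub>m 1\<^sub>m n)"
    using C by (simp add: mult_smult_distrib[of _ n n _ n])
  also have "eval_poly_mat f A * (a \<cdot>\<^sub>m 1\<^sub>m n) + eval_poly_mat f A * (eval_poly_mat g A * A) =
      eval_poly_mat f A * (a \<cdot>\<^sub>m 1\<^sub>m n + eval_poly_mat g A * A)"
    using C A by (intro mult_add_distrib_mat[symmetric, of _ n n _ n]) auto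
  finally show ?case by (simp add: eval_poly_mat_pCons[OF A])
qed

text \<open>
  Fix a column index \<open>j\<close>.  There are \<open>q^(n+1)\<close> polynomials of degree at most \<open>n\<close> but only \<open>q^n\<close> possible
  \<open>j\<close>-th columns, so the values of two of them at \<open>A\<close> agree in the \<open>j\<close>-th column.  Their difference
  divides \<open>\<Phi>\<close>, whose value therefore has zero \<open>j\<close>-th column.
\<close>

lemma eval_Phi_mat_eq_0:
  fixes A :: "'k::field_gcd mat"
  assumes fin: "finite (UNIV :: 'k set)" and A: "A \<in> carrier_mat n n"
  shows "eval_poly_mat (Phi (card (UNIV :: 'k set)) n) A = 0\<^sub>m n n"
proof (rule eq_matI)
  let ?q = "card (UNIV :: 'k set)"
  fix i j
  assume "i < dim_row (0\<^sub>m n n :: 'k mat)" "j < dim_col (0\<^sub>m n n :: 'k mat)"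
  then have ij: "i < n" "j < n" by auto
  define col_of where "col_of f = restrict (\<lambda>i. eval_poly_mat f A $$ (i, j)) {..<n}" for f
  let ?S = "polys_below (Suc n) :: 'k poly set"
  have "col_of ` ?S \<subseteq> (\<Pi>\<^sub>E i\<in>{..<n}. UNIV)"
    by (auto simp: col_of_def PiE_iff extensional_def split: if_splits)
  then have "card (col_of ` ?S) \<le> card (\<Pi>\<^sub>E i\<in>{..<n}. (UNIV :: 'k set))"
    by (rule card_mono[rotated]) (use fin in \<open>auto intro: finite_PiE\<close>)
  also have "\<dots> = ?q ^ n" by (simp add: card_PiE)
  also have "\<dots> < card ?S"
    using card_field_gt_1[OF fin] by (simp add: card_polys_below)
  finally have "\<not> inj_on col_of ?S" using pigeonhole by blast
  then obtain f g where fg: "f \<in> ?S" "g \<in> ?S" "f \<noteq> g" "col_of f = col_of g"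
    by (auto simp: inj_on_def)
  define h where "h = f - g"
  have h: "h \<noteq> 0" "degree h \<le> n"
    using fg by (auto simp: h_def polys_below_iff intro: degree_diff_le)
  have hcol: "eval_poly_mat h A $$ (l, j) = 0" if "l < n" for l
  proof -
    have "eval_poly_mat f A $$ (l, j) = eval_poly_mat g A $$ (l, j)"
      using fun_cong[OF fg(4), of l] that by (simp add: col_of_def)
    moreover have "eval_poly_mat f A = eval_poly_mat h A + eval_poly_mat g A"
      unfolding h_def eval_poly_mat_add[OF A, symmetric] by simp
    ultimately show ?thesis
      using that ij eval_poly_mat_carrier[OF A] by (simp add: carrier_matD[OF eval_poly_mat_carrier[OF A]])
  qed
  from dvd_Phi[OF fin h] obtain u where "Phi ?q n = h * u" ..
  then have "eval_poly_mat (Phi ?q n) A = eval_poly_mat u A * eval_poly_mat h A"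
    by (simp add: mult.commute[of h] eval_poly_mat_mult[OF A])
  then show "eval_poly_mat (Phi ?q n) A $$ (i, j) = (0\<^sub>m n n) $$ (i, j)"
    using ij hcol carrier_matD[OF eval_poly_mat_carrier[OF A]] by (simp add: scalar_prod_def)
qed (use A in \<open>auto simp: eval_poly_mat_def\<close>)

section \<open>Integer-valued polynomials as divisibility of matrix entries\<close>

interpretation red_poly_hom: map_poly_comm_ring_hom "red :: 'v::idom \<Rightarrow> 'v resid" ..

interpretation to_fract_hom: comm_ring_hom "to_fract :: 'v::idom \<Rightarrow> 'v fract"
  by unfold_locales simp_all

interpretation to_fract_poly: map_poly_comm_ring_hom "to_fract :: 'v::idom \<Rightarrow> 'v fract" ..

text \<open>
  The entries of \<open>g(B)\<close> for \<open>g\<close> and \<open>B\<close> over \<open>V\<close> itself, whereas \<^const>\<open>eval_poly_mat\<close> lives over fields.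
  Reduction modulo \<open>\<pi>\<close> and the embedding into \<open>K\<close> both map these entries to values of the latter.
\<close>

definition eval_entry :: "'a::comm_ring_1 poly \<Rightarrow> 'a mat \<Rightarrow> nat \<Rightarrow> nat \<Rightarrow> 'a" where
  "eval_entry g B i j = (\<Sum>k\<le>degree g. coeff g k * (B ^\<^sub>m k) $$ (i, j))"

lemma (in comm_ring_hom) hom_eval_entry:
  fixes g :: "'a poly"
  assumes "B \<in> carrier_mat n n" "i < n" "j < n"
  shows "hom (eval_entry g B i j) = (\<Sum>k\<le>degree g. coeff (map_poly hom g) k * (map_mat hom B ^\<^sub>m k) $$ (i, j))"
proof -
  have "hom ((B ^\<^sub>m k) $$ (i, j)) = (map_mat hom B ^\<^sub>m k) $$ (i, j)" for k
    using assms pow_carrier_mat[OF assms(1), of k] by (simp flip: mat_hom_pow[OF assms(1)])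
  then show ?thesis by (simp add: eval_entry_def hom_sum hom_mult)
qed

lemma eval_poly_mat_map:
  fixes g :: "'a::comm_ring_1 poly" and hom :: "'a \<Rightarrow> 'k::field"
  assumes hom: "comm_ring_hom hom" and B: "B \<in> carrier_mat n n" and ij: "i < n" "j < n"
  shows "eval_poly_mat (map_poly hom g) (map_mat hom B) $$ (i, j) = hom (eval_entry g B i j)"
proof -
  interpret comm_ring_hom hom by (rule hom)
  have "map_mat hom B \<in> carrier_mat n n" using B by simp
  from eval_poly_mat_index[OF this ij, of "map_poly hom g" "degree g"] show ?thesis
    by (simp add: hom_eval_entry[OF B ij] degree_map_poly_le)
qed

lemma integral_mats_times:
  assumes "A \<in> integral_mats n" "B \<in> integral_mats n"
  shows "A * B \<in> integral_mats n"
proof -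
  obtain A' B' where "A = map_mat to_fract A'" "B = map_mat to_fract B'"
    "A' \<in> carrier_mat n n" "B' \<in> carrier_mat n n"
    using assms by (auto simp: integral_mats_def)
  then have "A * B = map_mat to_fract (A' * B')" "A' * B' \<in> carrier_mat n n"
    by (auto simp: to_fract_hom.mat_hom_mult)
  then show ?thesis by (auto simp: integral_mats_def)
qed

lemma Int_mats_mult:
  assumes "f \<in> Int_mats n" "g \<in> Int_mats n"
  shows "f * g \<in> Int_mats n"
proof -
  have "eval_poly_mat (f * g) A = eval_poly_mat f A * eval_poly_mat g A" if "A \<in> integral_mats n" for A
    using that by (intro eval_poly_mat_mult) (auto simp: integral_mats_def)
  then show ?thesis
    using assms by (auto simp: Int_mats_def intro: integral_mats_times)
qed

text \<open>
  Moves the question from the fraction field to congruences in \<open>V\<close>.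
\<close>

lemma Int_mats_quotient_iff:
  fixes g :: "'v::idom poly"
  assumes "\<pi> \<noteq> 0"
  shows "smult (1 / to_fract \<pi> ^ k) (map_poly to_fract g) \<in> Int_mats n \<longleftrightarrow>
    (\<forall>B\<in>carrier_mat n n. \<forall>i<n. \<forall>j<n. \<pi> ^ k dvd eval_entry g B i j)"
    (is "?f \<in> _ \<longleftrightarrow> ?R")
proof -
  have nz: "to_fract \<pi> ^ k \<noteq> 0" using assms by simp
  have car: "map_mat to_fract B \<in> carrier_mat n n" if "B \<in> carrier_mat n n" for B :: "'v mat"
    using that by simp
  have entry: "to_fract \<pi> ^ k * eval_poly_mat ?f (map_mat to_fract B) $$ (i, j) = to_fract (eval_entry g B i j)"
    if "B \<in> carrier_mat n n" "i < n" "j < n" for B i j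
    using that nz carrier_matD[OF eval_poly_mat_carrier[OF car[OF that(1)]]]
    by (simp add: eval_poly_mat_smult[OF car[OF that(1)]]
        eval_poly_mat_map[OF to_fract_hom.comm_ring_hom_axioms that])
  show ?thesis
  proof
    assume f: "?f \<in> Int_mats n"
    show ?R
    proof (intro ballI allI impI)
      fix B :: "'v mat" and i j assume B: "B \<in> carrier_mat n n" "i < n" "j < n"
      then have "eval_poly_mat ?f (map_mat to_fract B) \<in> integral_mats n"
        using f by (auto simp: Int_mats_def integral_mats_def)
      then obtain C where C: "C \<in> carrier_mat n n" "eval_poly_mat ?f (map_mat to_fract B) = map_mat to_fract C"
        by (auto simp: integral_mats_def)
      have "to_fract (\<pi> ^ k * C $$ (i, j)) = to_fract (eval_entry g B i j)"
        using entry[OF B] C B by (simp add: to_fract_hom.hom_mult to_fract_hom.hom_power)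
      then show "\<pi> ^ k dvd eval_entry g B i j" by (metis dvd_triv_left to_fract_eq_iff)
    qed
  next
    assume R: ?R
    show "?f \<in> Int_mats n"
      unfolding Int_mats_def
    proof (intro CollectI ballI)
      fix A :: "'v fract mat" assume "A \<in> integral_mats n"
      then obtain B where B: "B \<in> carrier_mat n n" "A = map_mat to_fract B"
        by (auto simp: integral_mats_def)
      define C where "C = mat n n (\<lambda>(i, j). SOME c. eval_entry g B i j = \<pi> ^ k * c)"
      have C: "eval_entry g B i j = \<pi> ^ k * C $$ (i, j)" if "i < n" "j < n" for i j
        using R B that by (auto simp: C_def dvd_def intro: someI_ex)
      have "eval_poly_mat ?f A $$ (i, j) = map_mat to_fract C $$ (i, j)" if "i < n" "j < n" for i j
      proof -
        have "to_fract \<pi> ^ k * eval_poly_mat ?f A $$ (i, j) = to_fract \<pi> ^ k * to_fract (C $$ (i, j))"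
          using entry[OF B(1) that] C[OF that] B by (simp add: to_fract_hom.hom_mult to_fract_hom.hom_power)
        then have "eval_poly_mat ?f A $$ (i, j) = to_fract (C $$ (i, j))"
          using nz by (simp only: mult_cancel_left) simp
        then show ?thesis using that by (simp add: C_def)
      qed
      then have "eval_poly_mat ?f A = map_mat to_fract C"
        using carrier_matD[OF eval_poly_mat_carrier[OF car[OF B(1)]]] B
        by (intro eq_matI) (auto simp: C_def)
      then show "eval_poly_mat ?f A \<in> integral_mats n"
        by (auto simp: integral_mats_def C_def)
    qed
  qed
qed

lemma Int_mats_map_poly:
  fixes g :: "'v::idom poly"
  shows "map_poly to_fract g \<in> Int_mats n"
  using Int_mats_quotient_iff[of 1 0 g n] by simp

text \<open>
  The matrix of multiplication by \<open>x\<close> on \<open>V[x]/(F)\<close> in the basis \<open>1, x, \<dots>, x^(n-1)\<close>, for \<open>F\<close> monic of degree \<open>n\<close>.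
\<close>

definition companion :: "nat \<Rightarrow> 'a::comm_ring_1 poly \<Rightarrow> 'a mat" where
  "companion n F = mat n n (\<lambda>(i, j). if Suc j = n then - coeff F i else if i = Suc j then 1 else 0)"

text \<open>
  The \<open>j\<close>-th column of the \<open>k\<close>-th power of the companion matrix consists of the coordinates of
  \<open>x^k x^j\<close> in the basis \<open>1, x, \<dots>, x^(n-1)\<close>.
\<close>

lemma companion_power_cong:
  fixes F :: "'a::comm_ring_1 poly"
  assumes F: "lead_coeff F = 1" "degree F = n" and j: "j < n"
  shows "F dvd (\<Sum>i<n. monom ((companion n F ^\<^sub>m k) $$ (i, j)) i) - monom 1 (k + j)"
  using j
proof (induction k arbitrary: j)
  case 0
  have "(\<Sum>i<n. monom ((companion n F ^\<^sub>m 0) $$ (i, j)) i) = (\<Sum>i<n. if i = j then monom (1 :: 'a) j else 0)"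
    using 0 by (intro sum.cong) (auto simp: companion_def)
  also have "\<dots> = monom 1 j" using 0 by simp
  finally show ?case by simp
next
  case (Suc k)
  let ?C = "companion n F"
  have C: "?C \<in> carrier_mat n n" by (simp add: companion_def)
  have base: "F dvd (\<Sum>l<n. monom (?C $$ (l, j)) l) - monom 1 (Suc j)"
  proof (cases "Suc j = n")
    case True
    have "(\<Sum>l<n. monom (?C $$ (l, j)) l) = (\<Sum>l<n. - monom (coeff F l) l)"
      using True by (intro sum.cong) (auto simp: companion_def minus_monom)
    moreover have "(\<Sum>l<n. monom (coeff F l) l) = F - monom 1 n"
      using poly_as_sum_of_monoms[of F] F by (simp add: lessThan_Suc_atMost[symmetric] eq_diff_eq)
    ultimately have "(\<Sum>l<n. monom (?C $$ (l, j)) l) - monom 1 (Suc j) = - F"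
      using True by (simp add: sum_negf)
    then show ?thesis by simp
  next
    case False
    then have "(\<Sum>l<n. monom (?C $$ (l, j)) l) = (\<Sum>l<n. if l = Suc j then monom 1 (Suc j) else 0)"
      using Suc.prems by (intro sum.cong) (auto simp: companion_def)
    also have "\<dots> = monom 1 (Suc j)" using False Suc.prems by simp
    finally show ?thesis by simp
  qed
  define S where "S l = (\<Sum>i<n. monom ((?C ^\<^sub>m k) $$ (i, l)) i)" for l
  have "(\<Sum>i<n. monom ((?C ^\<^sub>m Suc k) $$ (i, j)) i) =
      (\<Sum>i<n. \<Sum>l<n. [:?C $$ (l, j):] * monom ((?C ^\<^sub>m k) $$ (i, l)) i)"
  proof (intro sum.cong refl)
    fix i assume "i \<in> {..<n}"
    then have "(?C ^\<^sub>m Suc k) $$ (i, j) = (\<Sum>l<n. (?C ^\<^sub>m k) $$ (i, l) * ?C $$ (l, j))"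
      using C Suc.prems pow_carrier_mat[OF C, of k] by (simp add: scalar_prod_def atLeast0LessThan)
    then show "monom ((?C ^\<^sub>m Suc k) $$ (i, j)) i = (\<Sum>l<n. [:?C $$ (l, j):] * monom ((?C ^\<^sub>m k) $$ (i, l)) i)"
      by (simp add: monom_sum smult_monom mult.commute)
  qed
  also have "\<dots> = (\<Sum>l<n. [:?C $$ (l, j):] * S l)"
    unfolding S_def sum_distrib_left by (rule sum.swap)
  also have "\<dots> - monom 1 (Suc k + j) =
      (\<Sum>l<n. [:?C $$ (l, j):] * (S l - monom 1 (k + l)))
      + monom 1 k * ((\<Sum>l<n. monom (?C $$ (l, j)) l) - monom 1 (Suc j))"
    by (simp add: sum_distrib_left smult_diff_right sum_subtractf right_diff_distrib smult_monom mult_monom)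
  finally show ?case
    using base Suc.IH by (auto intro!: dvd_add dvd_sum dvd_smult dvd_mult simp: S_def)
qed

text \<open>
  The first column of \<open>g(C)\<close> represents \<open>g\<close> modulo \<open>F\<close>.
\<close>

lemma monic_dvd_companion_eval:
  fixes F g :: "'a::comm_ring_1 poly"
  assumes F: "lead_coeff F = 1" "degree F = n" and n: "n > 0"
  shows "F dvd (\<Sum>i<n. monom (eval_entry g (companion n F) i 0) i) - g"
proof -
  let ?C = "companion n F"
  have "(\<Sum>i<n. monom (eval_entry g ?C i 0) i) =
      (\<Sum>s\<le>degree g. [:coeff g s:] * (\<Sum>i<n. monom ((?C ^\<^sub>m s) $$ (i, 0)) i))"
    unfolding eval_entry_def monom_sum sum_distrib_left
    by (subst sum.swap) (simp add: smult_monom)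
  moreover have "g = (\<Sum>s\<le>degree g. [:coeff g s:] * monom 1 s)"
    using poly_as_sum_of_monoms[of g] by (simp add: smult_monom)
  ultimately have "(\<Sum>i<n. monom (eval_entry g ?C i 0) i) - g =
      (\<Sum>s\<le>degree g. [:coeff g s:] * ((\<Sum>i<n. monom ((?C ^\<^sub>m s) $$ (i, 0)) i) - monom 1 s))"
    by (simp only: right_diff_distrib sum_subtractf)
  also have "F dvd \<dots>"
    using companion_power_cong[OF F n] by (intro dvd_sum dvd_mult) simp
  finally show ?thesis .
qed

section \<open>Divisibility modulo powers of \<open>\<pi>\<close>\<close>

abbreviation red_poly :: "'v::idom poly \<Rightarrow> 'v resid poly" where
  "red_poly \<equiv> map_poly red"

lemma red_poly_pCons: "red_poly (pCons a p) = pCons (red a) (red_poly p)"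
  by (rule poly_eqI) (simp add: coeff_map_poly coeff_pCons split: nat.split)

text \<open>
  The setting of the theorem in terms of types: the maximal ideal behind \<open>'v resid\<close> is generated by \<open>\<pi>\<close>.
\<close>

locale uniformizer =
  fixes \<pi> :: "'v::idom" and q :: nat
  assumes nonzero: "\<pi> \<noteq> 0"
    and red_eq_0_iff_dvd: "red a = 0 \<longleftrightarrow> \<pi> dvd a"
    and finite_resid: "finite (UNIV :: 'v resid set)"
    and card_resid: "card (UNIV :: 'v resid set) = q"
begin

lemma q_gt_1: "q > 1"
  using card_field_gt_1[OF finite_resid] card_resid by simp

lemma red_poly_eq_0_iff: "red_poly f = 0 \<longleftrightarrow> [:\<pi>:] dvd f"
  by (auto simp: poly_eq_iff coeff_map_poly red_eq_0_iff_dvd const_poly_dvd_iff)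

lemma red_poly_pi: "red_poly [:\<pi>:] = 0"
  by (simp add: red_poly_eq_0_iff)

definition dvd_mod :: "'v poly \<Rightarrow> 'v poly \<Rightarrow> nat \<Rightarrow> bool" where
  "dvd_mod a f k \<longleftrightarrow> (\<exists>x y. f = a * x + [:\<pi>:] ^ k * y)"

lemma dvd_mod_cong:
  assumes "dvd_mod a f k" and "f' = f + a * x + [:\<pi>:] ^ k * y"
  shows "dvd_mod a f' k"
proof -
  obtain u v where "f = a * u + [:\<pi>:] ^ k * v" using assms by (auto simp: dvd_mod_def)
  then have "f' = a * (u + x) + [:\<pi>:] ^ k * (v + y)" using assms by (simp add: algebra_simps)
  then show ?thesis unfolding dvd_mod_def by blast
qed

lemma dvd_mod_mult: "dvd_mod a f k \<Longrightarrow> dvd_mod a (g * f) k"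
  unfolding dvd_mod_def
  by (elim exE, rule_tac x = "g * x" in exI, rule_tac x = "g * y" in exI) (simp add: algebra_simps)

lemma dvd_mod_mono:
  assumes "dvd_mod a f k" "l \<le> k"
  shows "dvd_mod a f l"
proof -
  obtain x y where "f = a * x + [:\<pi>:] ^ k * y" using assms by (auto simp: dvd_mod_def)
  also have "[:\<pi>:] ^ k = [:\<pi>:] ^ l * [:\<pi>:] ^ (k - l)" using assms by (simp flip: power_add)
  finally show ?thesis unfolding dvd_mod_def mult.assoc by blast
qed

lemma dvd_mod_Suc_red:
  assumes "dvd_mod a f (Suc k)"
  shows "red_poly a dvd red_poly f"
proof -
  obtain x y where "f = a * x + [:\<pi>:] ^ Suc k * y" using assms by (auto simp: dvd_mod_def)
  then have "red_poly f = red_poly a * red_poly x"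
    by (simp only: red_poly_hom.hom_add red_poly_hom.hom_mult red_poly_hom.hom_power red_poly_pi) simp
  then show ?thesis by simp
qed

lemma dvd_mod_cancel_pi:
  assumes "dvd_mod a ([:\<pi>:] * f) (Suc k)" and a: "red_poly a \<noteq> 0"
  shows "dvd_mod a f k"
proof -
  obtain x y where xy: "[:\<pi>:] * f = a * x + [:\<pi>:] ^ Suc k * y"
    using assms by (auto simp: dvd_mod_def)
  then have "a * x = [:\<pi>:] * (f - [:\<pi>:] ^ k * y)" by (simp only: power_Suc right_diff_distrib mult.assoc) simp
  then have "red_poly (a * x) = 0" unfolding red_poly_eq_0_iff by (rule dvdI)
  then have "red_poly x = 0" using a by (simp add: red_poly_hom.hom_mult)
  then obtain z where "x = [:\<pi>:] * z" unfolding red_poly_eq_0_iff by (auto elim: dvdE)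
  with xy have "[:\<pi>:] * f = [:\<pi>:] * (a * z + [:\<pi>:] ^ k * y)" by (simp only: algebra_simps power_Suc)
  then have "f = a * z + [:\<pi>:] ^ k * y" using nonzero by (subst (asm) mult_cancel_left) simp
  then show ?thesis unfolding dvd_mod_def by blast
qed

text \<open>
  If \<open>u v = 1 - \<pi> z\<close>, then \<open>u v\<close> divides \<open>1 - (\<pi> z)^k\<close>, so \<open>u\<close> is invertible modulo \<open>\<pi>^k\<close>.
\<close>

lemma dvd_mod_cancel_unit:
  assumes f: "dvd_mod a ([:u:] * f) k" and u: "red u \<noteq> 0"
  shows "dvd_mod a f k"
proof -
  obtain v where "red v = inverse (red u)" using surj_red by (metis surjD)
  then have "red (1 - u * v) = 0" using u by (simp add: red_hom.hom_minus red_hom.hom_mult)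
  then obtain z where z: "1 - u * v = \<pi> * z" unfolding red_eq_0_iff_dvd by (auto elim: dvdE)
  have "1 - (\<pi> * z) ^ k = (1 - \<pi> * z) * (\<Sum>i<k. (\<pi> * z) ^ i)" by (rule one_diff_power_eq)
  also have "1 - \<pi> * z = u * v" using z by (simp add: algebra_simps)
  finally obtain t where t: "1 - (\<pi> * z) ^ k = u * v * t" by blast
  have "f = smult (u * v * t + (\<pi> * z) ^ k) f" by (simp flip: t)
  also have "\<dots> = [:v * t:] * ([:u:] * f) + a * 0 + [:\<pi>:] ^ k * ([:z ^ k:] * f)"
    by (simp add: smult_add_left poly_const_pow power_mult_distrib mult_ac)
  finally show ?thesis by (rule dvd_mod_cong[OF dvd_mod_mult[OF f]])
qed

text \<open>
  The core of the upper bound.  Write \<open>a\<^sub>i = A + \<pi> c\<^sub>i\<close> and \<open>b = A + \<pi> c'\<close>, all of which reduce to \<open>A\<close> modulo \<open>\<pi>\<close>.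
  In \<open>g = a\<^sub>k h\<close>, read modulo \<open>\<pi>^(k+2)\<close>, the factor \<open>a\<^sub>k\<close> is congruent to \<open>\<pi>(c\<^sub>k - c\<^sub>i)\<close> modulo \<open>a\<^sub>i\<close>, with \<open>c\<^sub>k - c\<^sub>i\<close>
  a unit; so the other \<open>a\<^sub>i\<close> divide \<open>h\<close> modulo \<open>\<pi>^(k+1)\<close>, and the induction proceeds with \<open>h\<close>.

  The polynomial \<open>c'\<close> may be congruent to one of the \<open>c\<^sub>i\<close> in some residue field of \<open>V[x]\<close>, so \<open>c\<^sub>k - c'\<close>
  cannot be cancelled.  It is collected in the multiplier \<open>w\<close> instead, which is why the divisibility by \<open>b\<close> is
  required of \<open>w g\<close> and not of \<open>g\<close>.
\<close>

lemma successive_division: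
  fixes c :: "nat \<Rightarrow> 'v" and c' w g A :: "'v poly"
  assumes A: "red_poly A \<noteq> 0"
    and "\<And>i j. i < k \<Longrightarrow> j < k \<Longrightarrow> i \<noteq> j \<Longrightarrow> red (c i) \<noteq> red (c j)"
    and "\<And>i. i < k \<Longrightarrow> dvd_mod (A + [:\<pi>:] * [:c i:]) g (Suc k)"
    and "dvd_mod (A + [:\<pi>:] * c') (w * g) (Suc k)"
  shows "\<exists>h. red_poly g = red_poly A ^ k * h \<and>
    red_poly A dvd red_poly w * (\<Prod>i<k. red_poly ([:c i:] - c')) * h"
  using assms(2-)
proof (induction k arbitrary: g w)
  case 0
  have "red_poly A dvd red_poly w * red_poly g"
    using dvd_mod_Suc_red[OF 0(3)]
    by (simp only: red_poly_hom.hom_mult red_poly_hom.hom_add red_poly_pi mult_zero_left add_0_right)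
  then show ?case by simp
next
  case (Suc k)
  define a where "a i = A + [:\<pi>:] * [:c i:]" for i
  define b where "b = A + [:\<pi>:] * c'"
  have red_a: "red_poly (a i) = red_poly A" for i
    by (simp only: a_def red_poly_hom.hom_add red_poly_hom.hom_mult red_poly_pi) simp
  have red_b: "red_poly b = red_poly A"
    by (simp only: b_def red_poly_hom.hom_add red_poly_hom.hom_mult red_poly_pi) simp
  have "dvd_mod (a k) g (Suc (Suc k))" unfolding a_def by (rule Suc.prems(2)) simp
  then obtain h r where g: "g = a k * h + [:\<pi>:] ^ Suc (Suc k) * r" by (auto simp: dvd_mod_def)
  have "dvd_mod (a i) h (Suc k)" if i: "i < k" for i
  proof -
    have "dvd_mod (a i) g (Suc (Suc k))" unfolding a_def by (rule Suc.prems(2)) (use i in simp)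
    moreover have "[:\<pi>:] * ([:c k - c i:] * h) = g + a i * (- h) + [:\<pi>:] ^ Suc (Suc k) * (- r)"
    proof -
      have *: "[:c k - c i:] = [:c k:] - [:c i:]" by simp
      have "p * ((x - y) * h) = (A + p * x) * h + s * r + (A + p * y) * (- h) + s * (- r)"
        for p x y s :: "'v poly" by (simp add: algebra_simps)
      then show ?thesis unfolding g a_def * .
    qed
    ultimately have "dvd_mod (a i) ([:\<pi>:] * ([:c k - c i:] * h)) (Suc (Suc k))"
      by (rule dvd_mod_cong)
    then have "dvd_mod (a i) ([:c k - c i:] * h) (Suc k)"
      by (rule dvd_mod_cancel_pi) (simp add: red_a A)
    moreover have "red (c k - c i) \<noteq> 0"
      using Suc.prems(1)[of k i] i by (simp add: red_hom.hom_minus)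
    ultimately show ?thesis by (rule dvd_mod_cancel_unit)
  qed
  moreover have "dvd_mod b (w * ([:c k:] - c') * h) (Suc k)"
  proof -
    have "dvd_mod b (w * g) (Suc (Suc k))" unfolding b_def by (rule Suc.prems(3))
    moreover have "[:\<pi>:] * (w * ([:c k:] - c') * h) = w * g + b * (- w * h) + [:\<pi>:] ^ Suc (Suc k) * (- w * r)"
    proof -
      have "p * (w * (x - c') * h) = w * ((A + p * x) * h + s * r) + (A + p * c') * (- w * h) + s * (- w * r)"
        for p x s :: "'v poly" by (simp add: algebra_simps)
      then show ?thesis unfolding g a_def b_def .
    qed
    ultimately have "dvd_mod b ([:\<pi>:] * (w * ([:c k:] - c') * h)) (Suc (Suc k))"
      by (rule dvd_mod_cong)
    then show ?thesis by (rule dvd_mod_cancel_pi) (simp add: red_b A)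
  qed
  ultimately obtain h' where h': "red_poly h = red_poly A ^ k * h'"
    "red_poly A dvd red_poly (w * ([:c k:] - c')) * (\<Prod>i<k. red_poly ([:c i:] - c')) * h'"
    using Suc.IH[of h "w * ([:c k:] - c')"] Suc.prems(1) unfolding a_def b_def by auto
  have "red_poly g = red_poly A * red_poly h"
    unfolding g by (simp only: red_poly_hom.hom_add red_poly_hom.hom_mult red_poly_hom.hom_power red_poly_pi red_a) simp
  then have "red_poly g = red_poly A ^ Suc k * h'" by (simp add: h'(1) mult.assoc)
  moreover have "red_poly A dvd red_poly w * (\<Prod>i<Suc k. red_poly ([:c i:] - c')) * h'"
    using h'(2) by (simp add: red_poly_hom.hom_mult mult_ac)
  ultimately show ?case by blast
qed

section \<open>Upper bound\<close>

lemma Int_mats_imp_dvd_mod: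
  assumes int: "smult (1 / to_fract \<pi> ^ k) (map_poly to_fract g) \<in> Int_mats n"
    and F: "lead_coeff F = 1" "degree F = n" and n: "n > 0"
  shows "dvd_mod F g k"
proof -
  let ?C = "companion n F"
  have "?C \<in> carrier_mat n n" by (simp add: companion_def)
  then have "\<pi> ^ k dvd eval_entry g ?C i 0" if "i < n" for i
    using int that n unfolding Int_mats_quotient_iff[OF nonzero] by blast
  then obtain e where e: "eval_entry g ?C i 0 = \<pi> ^ k * e i" if "i < n" for i
    unfolding dvd_def by metis
  have "(\<Sum>i<n. monom (eval_entry g ?C i 0) i) = [:\<pi>:] ^ k * (\<Sum>i<n. monom (e i) i)"
    by (simp add: e sum_distrib_left poly_const_pow smult_monom)
  moreover obtain u where "(\<Sum>i<n. monom (eval_entry g ?C i 0) i) - g = F * u"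
    using monic_dvd_companion_eval[OF F n, of g] by (rule dvdE)
  ultimately have "g = F * (- u) + [:\<pi>:] ^ k * (\<Sum>i<n. monom (e i) i)"
    by (simp add: algebra_simps)
  then show ?thesis unfolding dvd_mod_def by blast
qed

lemma residue_system_exists: "\<exists>c :: nat \<Rightarrow> 'v. inj_on (\<lambda>i. red (c i)) {..<q}"
proof -
  obtain h where h: "bij_betw h {0..<q} (UNIV :: 'v resid set)"
    using ex_bij_betw_nat_finite[OF finite_resid] card_resid by auto
  have "red (inv_into UNIV red x) = x" for x :: "'v resid" by (rule surj_f_inv_f[OF surj_red])
  then have "inj_on (\<lambda>i. red (inv_into UNIV red (h i))) {..<q}"
    using h by (simp add: bij_betw_def atLeast0LessThan)
  then show ?thesis by (rule exI[where x = "\<lambda>i. inv_into UNIV red (h i)"])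
qed

lemma monic_lift_exists:
  fixes P :: "'v resid poly"
  assumes P: "lead_coeff P = 1"
  shows "\<exists>Q. red_poly Q = P \<and> lead_coeff Q = 1 \<and> degree Q = degree P"
proof -
  define s where "s = (inv_into UNIV red :: 'v resid \<Rightarrow> 'v)"
  have s: "red (s x) = x" for x unfolding s_def by (rule surj_f_inv_f[OF surj_red])
  \<comment> \<open>The lift of coefficients is adjusted at \<open>0\<close> and \<open>1\<close> so that degree and leading coefficient are kept.\<close>
  define t where "t x = (if x = 0 then 0 else if x = 1 then 1 else s x)" for x
  have t: "red (t x) = x" for x by (simp add: t_def s)
  then have "t x \<noteq> 0" if "x \<noteq> 0" for x using that by (metis red_hom.hom_zero)
  then have deg: "degree (map_poly t P) = degree P" by (intro Polynomial.degree_map_poly)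
  have c: "coeff (map_poly t P) i = t (coeff P i)" for i
    by (rule coeff_map_poly) (simp add: t_def)
  have "red_poly (map_poly t P) = P"
    by (intro poly_eqI) (simp add: coeff_map_poly c t)
  moreover have "lead_coeff (map_poly t P) = 1" unfolding deg c P by (simp add: t_def)
  ultimately show ?thesis using deg by blast
qed

text \<open>
  \<open>successive_division\<close> with \<open>k\<close> constants in distinct residue classes, the last of them as \<open>c'\<close>: the differences
  are units, so they can be cancelled.
\<close>

lemma monic_power_dvd_red_poly:
  assumes g: "\<And>F. lead_coeff F = 1 \<Longrightarrow> degree F = n \<Longrightarrow> dvd_mod F g k"
    and k: "k \<le> q" and A: "lead_coeff A = 1" "degree A = n" and n: "n > 0"
  shows "red_poly A ^ k dvd red_poly g"
proof (cases k)
  case (Suc m)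
  obtain c :: "nat \<Rightarrow> 'v" where c: "inj_on (\<lambda>i. red (c i)) {..<q}"
    using residue_system_exists by blast
  have nz: "red_poly A \<noteq> 0"
  proof -
    have "coeff (red_poly A) n = 1" using A by (simp add: coeff_map_poly)
    then show ?thesis by (metis coeff_0 zero_neq_one)
  qed
  have mon: "dvd_mod (A + [:\<pi>:] * [:x:]) g (Suc m)" for x
  proof -
    have "degree (A + [:\<pi>:] * [:x:]) = n"
      using A n by (intro trans[OF degree_add_eq_left]) auto
    moreover have "coeff (A + [:\<pi>:] * [:x:]) n = 1"
      using A n by (cases n) auto
    ultimately show ?thesis using g[unfolded Suc] by metis
  qed
  have "\<exists>h. red_poly g = red_poly A ^ m * h \<and>
      red_poly A dvd red_poly 1 * (\<Prod>i<m. red_poly ([:c i:] - [:c m:])) * h"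
  proof (rule successive_division[OF nz])
    show "red (c i) \<noteq> red (c j)" if "i < m" "j < m" "i \<noteq> j" for i j
      using inj_onD[OF c, of i j] that k Suc by auto
    show "dvd_mod (A + [:\<pi>:] * [:c i:]) g (Suc m)" for i by (rule mon)
    show "dvd_mod (A + [:\<pi>:] * [:c m:]) (1 * g) (Suc m)" using mon by simp
  qed
  then obtain h where h: "red_poly g = red_poly A ^ m * h"
    "red_poly A dvd (\<Prod>i<m. red_poly ([:c i:] - [:c m:])) * h" by auto
  have "is_unit (\<Prod>i<m. red_poly ([:c i:] - [:c m:]))"
  proof -
    have "red (c i) \<noteq> red (c m)" if "i < m" for i
      using inj_onD[OF c, of i m] that k Suc by auto
    then have "is_unit (red_poly ([:c i:] - [:c m:]))" if "i < m" for i
      using that by (simp add: red_hom.hom_minus is_unit_pCons_iff red_poly_pCons)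
    then show ?thesis
      using prod_dvd_prod[of "{..<m}" "\<lambda>i. red_poly ([:c i:] - [:c m:])" "\<lambda>_. 1"] by simp
  qed
  then have "red_poly A dvd h" using h(2) by (simp add: dvd_mult_unit_iff' dvd_mult_unit_iff)
  then show ?thesis unfolding h Suc by (simp add: mult_dvd_mono mult.commute)
qed simp

text \<open>
  \<open>successive_division\<close> with \<open>A = x^n\<close>, all \<open>q\<close> residue classes and \<open>c' = c\<^sub>0 + x\<close>.  Modulo \<open>\<pi>\<close>, the product
  of the differences \<open>c\<^sub>i - c'\<close> is \<open>x\<close> times a polynomial with nonzero constant term, so \<open>x^n\<close> dividing
  this product times \<open>h\<close> still leaves \<open>x^(n-1)\<close> as a divisor of \<open>h\<close>.
\<close>

lemma X_power_dvd_red_poly: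
  assumes g: "\<And>F. lead_coeff F = 1 \<Longrightarrow> degree F = n \<Longrightarrow> dvd_mod F g (Suc q)" and n: "n \<ge> 2"
  shows "[:0, 1:] ^ Suc (n * q) dvd red_poly g"
proof -
  obtain c :: "nat \<Rightarrow> 'v" where c: "inj_on (\<lambda>i. red (c i)) {..<q}"
    using residue_system_exists by blast
  have q0: "0 < q" using q_gt_1 by simp
  define A where "A = (monom 1 n :: 'v poly)"
  define c' where "c' = [:c 0, 1:]"
  define x where "x = [:0, 1 :: 'v resid:]"
  have red_A: "red_poly A = x ^ n"
  proof -
    have "red_poly A = monom 1 n" by (simp add: A_def map_poly_monom)
    then show ?thesis by (simp add: x_def monom_altdef)
  qed
  have "\<exists>h. red_poly g = red_poly A ^ q * h \<and>
      red_poly A dvd red_poly 1 * (\<Prod>i<q. red_poly ([:c i:] - c')) * h"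
  proof (rule successive_division)
    show "red_poly A \<noteq> 0" by (simp add: red_A x_def)
    show "red (c i) \<noteq> red (c j)" if "i < q" "j < q" "i \<noteq> j" for i j
      using inj_onD[OF c, of i j] that by auto
    have mon: "dvd_mod (A + r) g (Suc q)" if "degree r < n" for r
    proof -
      have "degree (A + r) = n" using that by (simp add: A_def degree_add_eq_left degree_monom_eq)
      moreover have "coeff (A + r) n = 1" using that by (simp add: A_def coeff_eq_0)
      ultimately show ?thesis using g by metis
    qed
    show "dvd_mod (A + [:\<pi>:] * [:c i:]) g (Suc q)" for i using n by (intro mon) simp
    have "degree ([:\<pi>:] * c') < n" using n by (simp add: c'_def nonzero)
    then show "dvd_mod (A + [:\<pi>:] * c') (1 * g) (Suc q)" using mon by simp
  qed
  then obtain h where h: "red_poly g = x ^ (n * q) * h"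
    "x ^ n dvd (\<Prod>i<q. red_poly ([:c i:] - c')) * h" by (auto simp: red_A power_mult)
  have fac: "red_poly ([:c i:] - c') = [:red (c i) - red (c 0), - 1:]" for i
    by (simp add: c'_def red_hom.hom_minus red_hom.hom_uminus red_poly_pCons)
  have "(\<Prod>i<q. red_poly ([:c i:] - c')) = (- x) * (\<Prod>i\<in>{1..<q}. [:red (c i) - red (c 0), - 1:])"
    unfolding fac lessThan_atLeast0 using q0
    by (simp add: prod.atLeast_Suc_lessThan x_def)
  moreover have "x ^ n = x * x ^ (n - 1)" using n by (cases n) auto
  ultimately have "x * x ^ (n - 1) dvd x * ((\<Prod>i\<in>{1..<q}. [:red (c i) - red (c 0), - 1:]) * h)"
    using h(2) by simp
  then have "x ^ (n - 1) dvd (\<Prod>i\<in>{1..<q}. [:red (c i) - red (c 0), - 1:]) * h"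
    by (simp add: x_def del: mult_pCons_left)
  moreover have "x dvd x ^ (n - 1)" using n by (intro dvd_power) auto
  ultimately have "x dvd (\<Prod>i\<in>{1..<q}. [:red (c i) - red (c 0), - 1:]) * h" by (rule dvd_trans[rotated])
  then have "poly ((\<Prod>i\<in>{1..<q}. [:red (c i) - red (c 0), - 1:]) * h) 0 = 0"
    unfolding poly_eq_0_iff_dvd x_def by simp
  moreover have "red (c i) - red (c 0) \<noteq> 0" if "i \<in> {1..<q}" for i
    using inj_onD[OF c, of i 0] that by auto
  ultimately have "poly h 0 = 0" by (simp add: poly_prod)
  then have "x dvd h" unfolding poly_eq_0_iff_dvd x_def by simp
  then show ?thesis unfolding h x_def[symmetric] by (simp add: mult_dvd_mono mult.commute)
qed

text \<open>
  Let \<open>m = deg P\<close>, \<open>e = \<lfloor>n/m\<rfloor>\<close>, and let \<open>Q\<close> be a monic lift of \<open>P\<close>.  The monic polynomial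
  \<open>A = Q^e x^(n - e m)\<close> has degree \<open>n\<close>, and the \<open>k\<close>-th power of its reduction divides that of \<open>g\<close>.
\<close>

lemma multiplicity_Phi_power_le:
  assumes g: "\<And>F. lead_coeff F = 1 \<Longrightarrow> degree F = n \<Longrightarrow> dvd_mod F g k"
    and k: "k \<le> q" and n: "n > 0" and nz: "red_poly g \<noteq> 0" and P: "prime P"
  shows "multiplicity P (Phi q n ^ k) \<le> multiplicity P (red_poly g)"
proof -
  have Pe: "prime_elem P" using P by simp
  then have unit: "\<not> is_unit P" "P \<noteq> 0" by (auto simp: prime_elem_def)
  have "unit_factor P = 1" using P unit unit_factor_normalize[of P] by (simp add: prime_def)
  then have "lead_coeff P = 1" by (simp add: unit_factor_poly_def one_pCons)
  then obtain Q where Q: "red_poly Q = P" "lead_coeff Q = 1" "degree Q = degree P"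
    using monic_lift_exists by blast
  define e where "e = n div degree P"
  define A where "A = Q ^ e * monom 1 (n - e * degree P)"
  have "e * degree P \<le> n" by (simp add: e_def)
  moreover have "Q \<noteq> 0" using Q(2) by auto
  ultimately have "degree A = n"
    unfolding A_def by (simp add: degree_mult_eq degree_power_eq degree_monom_eq Q(3))
  moreover have "lead_coeff A = 1"
    unfolding A_def lead_coeff_mult lead_coeff_power Q(2) by (simp add: degree_monom_eq)
  ultimately have "red_poly A ^ k dvd red_poly g"
    using monic_power_dvd_red_poly[OF g k _ _ n] by blast
  moreover have "P ^ e dvd red_poly A" by (simp add: A_def red_poly_hom.hom_mult red_poly_hom.hom_power Q)
  then have "P ^ (e * k) dvd red_poly A ^ k" unfolding power_mult by (rule dvd_power_same)
  ultimately have "P ^ (e * k) dvd red_poly g" by (rule dvd_trans[rotated])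
  then have "e * k \<le> multiplicity P (red_poly g)"
    using nz unit by (intro multiplicity_geI)
  moreover have "multiplicity P (Phi q n ^ k) = k * e"
    using multiplicity_Phi[OF finite_resid Pe, of n] Pe
    by (simp add: prime_elem_multiplicity_power_distrib card_resid e_def Phi_nonzero[OF q_gt_1])
  ultimately show ?thesis by (simp add: mult.commute)
qed

lemma degree_ge_of_dvd_mod:
  assumes g: "\<And>F. lead_coeff F = 1 \<Longrightarrow> degree F = n \<Longrightarrow> dvd_mod F g k"
    and k: "k \<le> q" and n: "n > 0" and nz: "red_poly g \<noteq> 0"
  shows "k * degree (Phi q n :: 'v poly) \<le> degree g"
proof -
  have "(Phi q n :: 'v resid poly) \<noteq> 0" by (rule Phi_nonzero[OF q_gt_1])
  then have "Phi q n ^ k dvd red_poly g"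
    by (intro multiplicity_le_imp_dvd multiplicity_Phi_power_le[OF g k n nz]) auto
  from dvd_imp_degree_le[OF this nz] have "k * degree (Phi q n :: 'v resid poly) \<le> degree (red_poly g)"
    using \<open>Phi q n \<noteq> 0\<close> by (simp add: degree_power_eq mult.commute)
  then show ?thesis using degree_map_poly_le[of red g] by (simp add: degree_Phi[OF q_gt_1])
qed

text \<open>
  Compared with \<open>\<Phi>^q\<close>, the reduction of \<open>g\<close> contains the prime \<open>x\<close> once more.
\<close>

lemma degree_gt_of_dvd_mod_Suc:
  assumes g: "\<And>F. lead_coeff F = 1 \<Longrightarrow> degree F = n \<Longrightarrow> dvd_mod F g (Suc q)"
    and n: "n \<ge> 2" and nz: "red_poly g \<noteq> 0"
  shows "q * degree (Phi q n :: 'v poly) < degree g"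
proof -
  define x where "x = [:0, 1 :: 'v resid:]"
  have x: "prime x" "degree x = 1" "x \<noteq> 0"
    using normalize_monom[of "1 :: 'v resid" 1]
    by (auto simp: x_def prime_def prime_elem_linear_field_poly monom_Suc monom_0)
  have Phi: "(Phi q n :: 'v resid poly) \<noteq> 0" by (rule Phi_nonzero[OF q_gt_1])
  have g': "dvd_mod F g q" if "lead_coeff F = 1" "degree F = n" for F
    by (rule dvd_mod_mono[OF g[OF that]]) simp
  have "x * Phi q n ^ q dvd red_poly g"
  proof (rule multiplicity_le_imp_dvd)
    show "x * Phi q n ^ q \<noteq> 0" using x Phi by simp
    fix P :: "'v resid poly" assume P: "prime P"
    have mult: "multiplicity P (x * Phi q n ^ q) = multiplicity P x + multiplicity P (Phi q n ^ q)"
      using P x Phi by (intro prime_elem_multiplicity_mult_distrib) auto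
    show "multiplicity P (x * Phi q n ^ q) \<le> multiplicity P (red_poly g)"
    proof (cases "P = x")
      case True
      have "Suc (n * q) \<le> multiplicity x (red_poly g)"
        using X_power_dvd_red_poly[OF g n] nz x by (intro multiplicity_geI) (auto simp: x_def[symmetric])
      moreover have "multiplicity x (Phi q n ^ q) = q * n"
        using multiplicity_Phi[OF finite_resid, of x n] x Phi
        by (simp add: prime_elem_multiplicity_power_distrib card_resid)
      moreover have "multiplicity x x = 1" using x by (intro multiplicity_self) auto
      ultimately show ?thesis unfolding mult unfolding True by (simp add: mult.commute)
    next
      case False
      then show ?thesis
        using mult multiplicity_Phi_power_le[OF g' _ _ nz P] n prime_multiplicity_other[OF P x(1)] by simp
    qed
  qed
  from dvd_imp_degree_le[OF this nz] have "1 + q * degree (Phi q n :: 'v resid poly) \<le> degree (red_poly g)"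
    using x Phi by (simp add: degree_mult_eq degree_power_eq mult.commute)
  then show ?thesis using degree_map_poly_le[of red g] by (simp add: degree_Phi[OF q_gt_1])
qed

section \<open>The \<open>\<pi>\<close>-sequence\<close>

lemma Phi_quotient_in_Int_mats:
  "smult (1 / to_fract \<pi> ^ 1) (map_poly to_fract (Phi q n)) \<in> Int_mats n"
  unfolding Int_mats_quotient_iff[OF nonzero]
proof (intro ballI allI impI)
  fix B :: "'v mat" and i j assume B: "B \<in> carrier_mat n n" "i < n" "j < n"
  have "red (eval_entry (Phi q n) B i j) = eval_poly_mat (Phi q n) (map_mat red B) $$ (i, j)"
    using eval_poly_mat_map[OF red_hom.comm_ring_hom_axioms B, of "Phi q n"]
    by (simp add: map_poly_Phi[OF red_hom.comm_ring_hom_axioms])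
  also have "\<dots> = 0"
    using eval_Phi_mat_eq_0[OF finite_resid, of "map_mat red B" n] B by (simp add: card_resid)
  finally show "\<pi> ^ 1 dvd eval_entry (Phi q n) B i j" by (simp add: red_eq_0_iff_dvd)
qed

lemma Phi_power_quotient_in_Int_mats:
  "smult (1 / to_fract \<pi> ^ k) (map_poly to_fract (Phi q n ^ k * g)) \<in> Int_mats n"
proof (induction k)
  case 0
  then show ?case by (simp add: Int_mats_map_poly)
next
  case (Suc k)
  from Int_mats_mult[OF Phi_quotient_in_Int_mats[of n] Suc] show ?case
    by (simp add: to_fract_poly.hom_mult mult.assoc mult.commute[of "to_fract \<pi>"])
qed

text \<open>
  If the exponent \<open>k\<close> exceeds \<open>s = \<lfloor>d/D\<rfloor>\<close>, the divisibilities hold modulo \<open>\<pi>^(s+1)\<close> as well.  For \<open>s < q\<close>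
  this contradicts \<open>d < (s+1) D\<close>; otherwise \<open>s = q\<close> and \<open>d = q D\<close>, where the stronger bound applies.
\<close>

lemma pi_sequence_eq:
  assumes n: "n \<ge> 2" and d: "d \<le> q * degree (Phi q n :: 'v poly)"
  shows "pi_sequence \<pi> n d = d div degree (Phi q n :: 'v poly)"
proof -
  define D where "D = degree (Phi q n :: 'v poly)"
  define K where "K = {k. \<exists>f g. f \<in> Int_mats n \<and> degree f = d \<and> lowest_terms \<pi> f g k}"
  have "q ^ 1 \<le> D"
    unfolding D_def degree_Phi[OF q_gt_1] using n by (intro member_le_sum) auto
  then have D: "D > 0" using q_gt_1 by simp
  have deg: "degree (smult (1 / to_fract \<pi> ^ k) (map_poly to_fract g)) = degree g" for g :: "'v poly" and k
    using nonzero by (simp add: Polynomial.degree_map_poly)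
  have upper: "k \<le> d div D" if "k \<in> K" for k
  proof (rule ccontr)
    assume k: "\<not> k \<le> d div D"
    from that obtain f g where f: "f \<in> Int_mats n" "degree f = d" "lowest_terms \<pi> f g k"
      by (auto simp: K_def)
    then have fg: "f = smult (1 / to_fract \<pi> ^ k) (map_poly to_fract g)" and "\<not> [:\<pi>:] dvd g"
      using k by (auto simp: lowest_terms_def)
    then have nz: "red_poly g \<noteq> 0" by (simp add: red_poly_eq_0_iff)
    have deg_g: "degree g = d" using f(2) unfolding fg deg .
    have div: "dvd_mod F g (Suc (d div D))" if "lead_coeff F = 1" "degree F = n" for F
    proof (rule dvd_mod_mono)
      show "dvd_mod F g k"
        using f(1) n that unfolding fg by (intro Int_mats_imp_dvd_mod[where n = n]) auto
    qed (use k in simp)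
    show False
    proof (cases "Suc (d div D) \<le> q")
      case True
      have "Suc (d div D) * D \<le> d"
        using degree_ge_of_dvd_mod[OF div True _ nz] n by (simp add: D_def deg_g)
      then show False using div_less_iff_less_mult[OF D, of d "Suc (d div D)"] by simp
    next
      case False
      moreover have "d div D \<le> q" using div_le_mono[OF d, of D] D by (simp add: D_def)
      ultimately have q: "d div D = q" by simp
      have "q * D < d" using degree_gt_of_dvd_mod_Suc[OF div[unfolded q] n nz] by (simp add: D_def deg_g)
      then show False using d by (simp add: D_def)
    qed
  qed
  have "d div D \<in> K"
  proof -
    let ?k = "d div D"
    define g where "g = Phi q n ^ ?k * monom (1 :: 'v) (d mod D)"
    have lc: "lead_coeff g = 1"
      unfolding g_def lead_coeff_mult lead_coeff_power lead_coeff_Phi[OF q_gt_1] by (simp add: degree_monom_eq)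
    have "degree g = ?k * D + d mod D"
      unfolding g_def using Phi_nonzero[OF q_gt_1, of n, where ?'a = 'v]
      by (simp add: degree_mult_eq degree_power_eq degree_monom_eq D_def mult.commute)
    then have "degree g = d" by simp
    moreover have "\<not> [:\<pi>:] dvd g"
    proof
      assume "[:\<pi>:] dvd g"
      then have "\<pi> dvd 1" using lc by (metis const_poly_dvd_iff)
      then show False using red_eq_0_iff_dvd[of 1] by simp
    qed
    ultimately show ?thesis
      unfolding K_def lowest_terms_def
      using Phi_power_quotient_in_Int_mats[of ?k n "monom 1 (d mod D)"] deg[of ?k g]
      unfolding g_def[symmetric] by blast
  qed
  moreover have "finite K" using upper by (intro finite_subset[of K "{..d div D}"]) auto
  ultimately have "Max K = d div D" using upper by (intro Max_eqI) auto
  then show ?thesis by (simp add: pi_sequence_def K_def D_def)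
qed

end

lemma uniformizerI:
  fixes \<pi> :: "'v::idom"
  assumes dvr: "discrete_valuation_ring (type_ring :: 'v ring)"
    and max: "maximalideal (PIdl\<^bsub>type_ring\<^esub> \<pi>) (type_ring :: 'v ring)"
    and fin: "finite (carrier (type_ring Quot (PIdl\<^bsub>type_ring\<^esub> \<pi>)))"
    and q: "q = card (carrier (type_ring Quot (PIdl\<^bsub>type_ring\<^esub> \<pi>)))"
  shows "uniformizer \<pi> q"
proof
  have M: "max_ideal = PIdl\<^bsub>type_ring\<^esub> \<pi>" by (rule max_ideal_eqI[OF dvr max])
  show "red a = 0 \<longleftrightarrow> \<pi> dvd a" for a
    by (simp add: red_eq_0_iff M PIdl_type_ring)
  show "\<pi> \<noteq> 0"
  proof
    assume "\<pi> = 0"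
    then have "PIdl\<^bsub>type_ring\<^esub> \<pi> = {\<zero>\<^bsub>type_ring\<^esub>}"
      unfolding PIdl_type_ring by (auto simp: ring_of_type_algebra_def)
    then have "field (type_ring :: 'v ring)"
      using cring.zeromaximalideal_fieldI[OF cring_from_type_algebra] max by metis
    then show False using dvr by (simp add: discrete_valuation_ring_def)
  qed
  note bij = bij_betw_quotient_resid[where ?'v = 'v, unfolded M]
  show "finite (UNIV :: 'v resid set)" using bij_betw_finite[OF bij] fin by simp
  show "card (UNIV :: 'v resid set) = q" using bij_betw_same_card[OF bij] q by simp
qed

theorem corollary4p20:
  fixes \<pi> :: "'v::idom" and n q d :: nat
  assumes "discrete_valuation_ring (type_ring :: 'v ring)"
    and "maximalideal (PIdl\<^bsub>type_ring\<^esub> \<pi>) (type_ring :: 'v ring)"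
    and "finite (carrier (type_ring Quot (PIdl\<^bsub>type_ring\<^esub> \<pi>)))"
    and "q = card (carrier (type_ring Quot (PIdl\<^bsub>type_ring\<^esub> \<pi>)))"
    and "n \<ge> 2"
    and "d \<le> q * Polynomial.degree (Phi q n :: 'v poly)"
  shows "int (pi_sequence \<pi> n d)
    = \<lfloor>real d / real (Polynomial.degree (Phi q n :: 'v poly))\<rfloor>"
proof -
  interpret uniformizer \<pi> q by (rule uniformizerI[OF assms(1-4)])
  show ?thesis
    unfolding pi_sequence_eq[OF assms(5,6)] by (rule floor_divide_of_nat_eq[symmetric])
qed

end
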